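(* Let $E,A\in\mathbb{K}^{n\times n}$ be such that $\operatorname{ran}\begin{bmatrix}E\\ A\end{bmatrix}=\mathcal{D}\mathcal{L}$, where $\mathcal{D}\subseteq\mathbb{K}^{2n}$ is a maximally dissipative linear relation and $\mathcal{L}=(\operatorname{gr}Q)^{-1}$ for some positive definite $Q\in\mathbb{K}^{n\times n}$. Then the matrix pencil $sE-A$ is regular and has index at most one.
   Context: $\mathbb{K}\in\{\mathbb{R},\mathbb{C}\}$, and $\mathbb{K}^n$ carries the inner product $\langle x,y\rangle=y^*x$. Positive definite matrices are Hermitian by convention. A linear relation in $\mathbb{K}^n$ is a linear subspace of $\mathbb{K}^{2n}\cong\mathbb{K}^n\times\mathbb{K}^n$. The graph of $M\in\mathbb{K}^{n\times n}$ is $\operatorname{gr}M=\{(x,Mx): x\in\mathbb{K}^n\}$; the inverse is $\mathcal{M}^{-1}=\{(y,x):(x,y)\in\mathcal{M}\}$; the product is $\mathcal{D}\mathcal{L}=\{(x,z) : \exists y\in\mathbb{K}^n,\ (x,y)\in\mathcal{L},\ (y,z)\in\mathcal{D}\}$. $\mathcal{M}$ is dissipative if $\operatorname{Re}\langle x,y\rangle\le 0$ for all $(x,y)\in\mathcal{M}$, and maximally dissipative if it is dissipative and not a proper subspace of a dissipative linear relation. A square pencil $sE-A\in\mathbb{K}[s]^{n\times n}$ is regular if $\det(sE-A)$ is not the zero polynomial. In this case there are invertible $S,T\in\mathbb{K}^{n\times n}$ with $S(sE-A)T=\operatorname{diag}(sI_{n_0}-J,\ sN-I_{n-n_0})$,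 where $J$ is in Jordan canonical form and $N$ is a block diagonal matrix of nilpotent Jordan blocks; the index is the size of the largest block of $N$ (and $0$ if $N$ is empty). *)

theory Defs
  imports
    "Jordan_Normal_Form.Jordan_Normal_Form_Existence"
    "Jordan_Normal_Form.Schur_Decomposition"
    "Jordan_Normal_Form.VS_Connect"
begin

section \<open>The scalar field\<close>

text \<open>Up to isomorphism, the only types in this class are \<^typ>\<open>real\<close> and \<^typ>\<open>complex\<close>,
  with their usual conjugation and order: \<open>to_complex\<close> is an injective field homomorphism
  (a homomorphism of fields is injective), and its range is pinned down by the last axiom.
  The order is the one of \<^theory>\<open>HOL-Library.Complex_Order\<close>, so \<open>0 < a\<close> says that
  \<open>a\<close> is real and positive.\<close>

class real_or_complex = conjugatable_ordered_field +
  fixes to_complex :: "'a \<Rightarrow> complex"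
  assumes to_complex_one: "to_complex 1 = 1"
    and to_complex_add: "to_complex (a + b) = to_complex a + to_complex b"
    and to_complex_mult: "to_complex (a * b) = to_complex a * to_complex b"
    and to_complex_conjugate: "to_complex (conjugate a) = cnj (to_complex a)"
    and to_complex_less_eq: "a \<le> b \<longleftrightarrow> to_complex a \<le> to_complex b"
    and range_to_complex: "range to_complex = \<real> \<or> range to_complex = UNIV"

instantiation real :: real_or_complex
begin
definition to_complex_real :: "real \<Rightarrow> complex" where "to_complex_real = complex_of_real"
instance
  by intro_classes (auto simp: to_complex_real_def Reals_def less_eq_complex_def)
end

instantiation complex :: real_or_complex
begin
definition to_complex_complex :: "complex \<Rightarrow> complex" where "to_complex_complex = id"
instance
  by intro_classes (auto simp: to_complex_complex_def)
end

section \<open>Linear relations\<close>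

text \<open>The inner product \<open>\<langle>x, y\<rangle> = y\<^sup>* x\<close> is the library's \<open>x \<bullet>c y\<close>.\<close>

definition positive_definite :: "nat \<Rightarrow> 'a :: real_or_complex mat \<Rightarrow> bool" where
  "positive_definite n Q \<longleftrightarrow>
     Q \<in> carrier_mat n n \<and> mat_adjoint Q = Q \<and>
     (\<forall>x \<in> carrier_vec n. x \<noteq> 0\<^sub>v n \<longrightarrow> 0 < (Q *\<^sub>v x) \<bullet>c x)"

text \<open>The identification of \<open>K\<^sup>n \<times> K\<^sup>n\<close> with \<open>K\<^bsup>2n\<^esup>\<close> is concatenation. With relations
  represented as sets of pairs, the inverse is \<open>converse\<close>, and the product \<open>D L\<close> (first
  \<open>L\<close>, then \<open>D\<close>) is \<open>L O D\<close>.\<close>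

definition linear_relation :: "nat \<Rightarrow> ('a :: field vec \<times> 'a vec) set \<Rightarrow> bool" where
  "linear_relation n M \<longleftrightarrow>
     M \<subseteq> carrier_vec n \<times> carrier_vec n \<and>
     VectorSpace.subspace class_ring ((\<lambda>(x, y). x @\<^sub>v y) ` M) (module_vec TYPE('a) (2 * n))"

definition graph_of :: "'a :: field mat \<Rightarrow> ('a vec \<times> 'a vec) set" where
  "graph_of M = {(x, M *\<^sub>v x) | x. x \<in> carrier_vec (dim_col M)}"

definition range_of_pair :: "'a :: field mat \<Rightarrow> 'a mat \<Rightarrow> ('a vec \<times> 'a vec) set" where
  "range_of_pair E A = {(E *\<^sub>v x, A *\<^sub>v x) | x. x \<in> carrier_vec (dim_col E)}"

definition dissipative :: "('a :: real_or_complex vec \<times> 'a vec) set \<Rightarrow> bool" where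
  "dissipative M \<longleftrightarrow> (\<forall>(x, y) \<in> M. Re (to_complex (x \<bullet>c y)) \<le> 0)"

definition maximally_dissipative ::
    "nat \<Rightarrow> ('a :: real_or_complex vec \<times> 'a vec) set \<Rightarrow> bool" where
  "maximally_dissipative n M \<longleftrightarrow>
     linear_relation n M \<and> dissipative M \<and>
     \<not> (\<exists>M'. linear_relation n M' \<and> dissipative M' \<and> M \<subset> M')"

section \<open>Matrix pencils\<close>

text \<open>The pencil \<open>sE - A\<close>, as a matrix of polynomials in the indeterminate \<open>s\<close>.\<close>

definition pencil :: "'a :: field mat \<Rightarrow> 'a mat \<Rightarrow> 'a poly mat" where
  "pencil E A = map_mat (\<lambda>a. monom a 1) E - map_mat (\<lambda>a. [:a:]) A"

definition regular_pencil :: "'a :: field mat \<Rightarrow> 'a mat \<Rightarrow> bool" where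
  "regular_pencil E A \<longleftrightarrow> det (pencil E A) \<noteq> 0"

text \<open>The real Jordan block of size \<open>2k\<close> for the pair of eigenvalues \<open>a \<plusminus> ib\<close>: it has
  \<open>k\<close> diagonal blocks with rows \<open>(a, b)\<close> and \<open>(-b, a)\<close>, and \<open>2\<times>2\<close> identity matrices on
  the block superdiagonal.\<close>

definition real_jordan_block :: "nat \<Rightarrow> 'a :: field \<Rightarrow> 'a \<Rightarrow> 'a mat" where
  "real_jordan_block k a b = mat (2 * k) (2 * k) (\<lambda>(i, j).
     if i div 2 = j div 2 then (if i = j then a else if i < j then b else - b)
     else if j = i + 2 then 1 else 0)"

text \<open>Over the reals, a matrix with nonreal eigenvalues is not similar to a direct sum of
  ordinary Jordan blocks; there, Jordan canonical form means real Jordan canonical form.\<close>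

definition jordan_canonical :: "'a :: real_or_complex mat \<Rightarrow> bool" where
  "jordan_canonical J \<longleftrightarrow> (\<exists>Bs. J = diag_block_mat Bs \<and>
     (\<forall>B \<in> set Bs.
        (\<exists>k a. 0 < k \<and> B = jordan_block k a) \<or>
        (range (to_complex :: 'a \<Rightarrow> complex) = \<real> \<and>
           (\<exists>k a b. 0 < k \<and> 0 < b \<and> B = real_jordan_block k a b))))"

text \<open>\<open>S (sE - A) T = diag (sI - J, sN - I)\<close>, where \<open>ks\<close> lists the sizes of the nilpotent
  Jordan blocks of \<open>N\<close>.\<close>

definition weierstrass_form ::
    "'a :: real_or_complex mat \<Rightarrow> 'a mat \<Rightarrow> 'a mat \<Rightarrow> 'a mat \<Rightarrow> 'a mat \<Rightarrow> nat list \<Rightarrow> bool" where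
  "weierstrass_form E A S T J ks \<longleftrightarrow>
     (let n = dim_row E; n0 = dim_row J; m = sum_list ks;
          N = jordan_matrix (map (\<lambda>k. (k, 0)) ks)
      in S \<in> carrier_mat n n \<and> invertible_mat S \<and>
         T \<in> carrier_mat n n \<and> invertible_mat T \<and>
         jordan_canonical J \<and> 0 \<notin> set ks \<and> n0 + m = n \<and>
         map_mat (\<lambda>a. [:a:]) S * pencil E A * map_mat (\<lambda>a. [:a:]) T =
           four_block_mat (pencil (1\<^sub>m n0) J) (0\<^sub>m n0 m) (0\<^sub>m m n0) (pencil N (1\<^sub>m m)))"

text \<open>The value is meaningful for regular pencils, for which a Weierstrass form exists and
  determines the block sizes of \<open>N\<close> up to order. The \<open>0\<close> covers the case of empty \<open>N\<close>.\<close>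

definition pencil_index :: "'a :: real_or_complex mat \<Rightarrow> 'a mat \<Rightarrow> nat" where
  "pencil_index E A =
     (THE k. \<exists>S T J ks. weierstrass_form E A S T J ks \<and> k = Max (insert 0 (set ks)))"

end

(* A point of D L is (Q x, z) with (x, z) in D, so D consists of the pairs (B v, A v) for
   B = Q^-1 E. Maximality makes A - B invertible: otherwise adjoining (w, -w), with w orthogonal
   to the range of A - B, would give a larger dissipative relation. Hence E and A have no common
   kernel vector. Testing dissipativity on v gives that det (E - A) is nonzero, and testing it on
   w + c u, for real c, shows that E u = 0 and E w = A u force u = 0.

   The index is the value of a definite description, so a Weierstrass form must exist. For
   F = (E - A)^-1 E the pencil is strictly equivalent to s F - (F - 1), and F is similar to
   diag (C, 0) with C invertible, which leads to J as the Jordan form of 1 - C^-1. The real Jordan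
   form comes from the complex one: its blocks occur in conjugate pairs because the Jordan form is
   unique, and real matrices that are similar over the complex numbers are similar over the
   reals. *)

theory Submission
  imports Defs "Jordan_Normal_Form.Jordan_Normal_Form_Uniqueness"
begin

section \<open>Square matrices over a field\<close>

text \<open>Only two facts about \<open>E\<close> and \<open>A\<close> reach the pencil part:
  \<open>det (E - A)\<close> is not zero, and \<open>no_chain_at_infinity\<close>. The point s = 1
  is as good as any s > 0: E v = A v turns the dissipative form at v into <Q^-1 E v, E v>, which is
  positive unless E v = 0.

  The second fact is invariant under strict equivalence and serves both halves of the definite
  description. In an arbitrary Weierstrass form it forces N = 0, so the index depends only on
  whether E is singular, and two forms cannot disagree. For F it says that F and F^2 have the same
  kernel; the Jordan blocks of F at 0 then have size one, which is why F splits as diag (C, 0) and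
  the general Weierstrass theorem is not called for.\<close>

lemma det_nonzero_obtain_inverse:
  fixes A :: "'a :: field mat"
  assumes A: "A \<in> carrier_mat n n" and det: "det A \<noteq> 0"
  obtains B where "B \<in> carrier_mat n n" "A * B = 1\<^sub>m n" "B * A = 1\<^sub>m n"
  using det_non_zero_imp_unit[OF A det, where b = "()"]
  unfolding Units_def by (auto simp: ring_mat_simps)

lemma det_nonzeroI:
  fixes A :: "'a :: field mat"
  assumes A: "A \<in> carrier_mat n n"
    and inj: "\<And>v. v \<in> carrier_vec n \<Longrightarrow> A *\<^sub>v v = 0\<^sub>v n \<Longrightarrow> v = 0\<^sub>v n"
  shows "det A \<noteq> 0"
  using inj unfolding det_0_iff_vec_prod_zero_field[OF A] by blast

lemma det_nonzeroD:
  fixes A :: "'a :: field mat"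
  assumes A: "A \<in> carrier_mat n n" and "det A \<noteq> 0"
    and "v \<in> carrier_vec n" "A *\<^sub>v v = 0\<^sub>v n"
  shows "v = 0\<^sub>v n"
  using assms(2-) unfolding det_0_iff_vec_prod_zero_field[OF A] by blast

lemma det_nonzero_left_inverse:
  fixes A :: "'a :: field mat"
  assumes "A \<in> carrier_mat n n" "B \<in> carrier_mat n n" "A * B = 1\<^sub>m n"
  shows "det A \<noteq> 0" "det B \<noteq> 0"
proof -
  have "det A * det B = 1" using assms by (metis det_mult det_one)
  then show "det A \<noteq> 0" "det B \<noteq> 0" by auto
qed

lemma invertible_mat_iff_det:
  fixes A :: "'a :: field mat"
  assumes A: "A \<in> carrier_mat n n"
  shows "invertible_mat A \<longleftrightarrow> det A \<noteq> 0"
proof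
  assume "invertible_mat A"
  then obtain B where AB: "A * B = 1\<^sub>m n" and BA: "B * A = 1\<^sub>m (dim_row B)"
    using A unfolding invertible_mat_def inverts_mat_def by auto
  have "dim_col B = n" "dim_row B = n"
    using arg_cong[OF AB, of dim_col] arg_cong[OF BA, of dim_col] A by auto
  then show "det A \<noteq> 0" using det_nonzero_left_inverse[OF A _ AB] by auto
next
  assume "det A \<noteq> 0"
  from det_nonzero_obtain_inverse[OF A this] obtain B where
    "B \<in> carrier_mat n n" "A * B = 1\<^sub>m n" "B * A = 1\<^sub>m n" .
  then show "invertible_mat A"
    using A unfolding invertible_mat_def inverts_mat_def by auto
qed

section \<open>Block diagonal matrices up to similarity\<close>

text \<open>The zero blocks take their sizes from the operands exactly as in the recursion of
  \<open>diag_block_mat\<close>, so that results on two blocks pass to lists of blocks by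
  unfolding.\<close>

abbreviation block_diag :: "'a :: zero mat \<Rightarrow> 'a mat \<Rightarrow> 'a mat" where
  "block_diag A D \<equiv>
     four_block_mat A (0\<^sub>m (dim_row A) (dim_col D)) (0\<^sub>m (dim_row D) (dim_col A)) D"

lemma block_diag_mult:
  assumes "A \<in> carrier_mat n n" "D \<in> carrier_mat m m"
    and "A' \<in> carrier_mat n n" "D' \<in> carrier_mat m m"
  shows "block_diag A D * block_diag A' D' = block_diag (A * A') (D * D')"
  using assms by (subst mult_four_block_mat[of _ n n _ m _ m _ _ n _ m]) auto

lemma block_diag_minus:
  fixes A :: "'a :: group_add mat"
  assumes "A \<in> carrier_mat n n" "D \<in> carrier_mat m m"
    and "A' \<in> carrier_mat n n" "D' \<in> carrier_mat m m"
  shows "block_diag A D - block_diag A' D' = block_diag (A - A') (D - D')"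
  using assms by (intro eq_matI) auto

lemma block_diag_one: "block_diag (1\<^sub>m n) (1\<^sub>m m) = 1\<^sub>m (n + m)"
  by simp

lemma det_block_diag:
  fixes A :: "'a :: idom mat"
  assumes "A \<in> carrier_mat n n" "D \<in> carrier_mat m m"
  shows "det (block_diag A D) = det A * det D"
  using assms by (subst det_four_block_mat_lower_left_zero[of _ n _ m]) auto

lemma diag_block_mat_square_carrier:
  assumes "\<And>B. B \<in> set Bs \<Longrightarrow> square_mat B"
  shows "diag_block_mat Bs \<in> carrier_mat (sum_list (map dim_row Bs)) (sum_list (map dim_row Bs))"
proof -
  have "sum_list (map dim_col Bs) = sum_list (map dim_row Bs)"
    using assms by (induct Bs) auto
  then show ?thesis by (intro carrier_matI) (simp_all add: dim_diag_block_mat)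
qed

text \<open>Conjugation by the permutation matrix \<open>P\<close> that exchanges the two groups of
  coordinates; \<open>Q\<close> is its transpose and inverse.\<close>

lemma similar_block_diag_swap:
  fixes A :: "'a :: comm_ring_1 mat"
  assumes A: "A \<in> carrier_mat n n" and D: "D \<in> carrier_mat m m"
  shows "similar_mat (block_diag A D) (block_diag D A)"
proof -
  define P :: "'a mat" where "P = four_block_mat (0\<^sub>m n m) (1\<^sub>m n) (1\<^sub>m m) (0\<^sub>m m n)"
  define Q :: "'a mat" where "Q = four_block_mat (0\<^sub>m m n) (1\<^sub>m m) (1\<^sub>m n) (0\<^sub>m n m)"
  have PQ: "P * Q = 1\<^sub>m (n + m)"
    unfolding P_def Q_def by (subst mult_four_block_mat[of _ n m _ n _ m _ _ n _ m]) auto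
  have QP: "Q * P = 1\<^sub>m (n + m)"
    unfolding P_def Q_def
    by (subst mult_four_block_mat[of _ m n _ m _ n _ _ m _ n]) (auto simp: add.commute)
  have "P * block_diag D A = four_block_mat (0\<^sub>m n m) A D (0\<^sub>m m n)"
    using A D unfolding P_def by (subst mult_four_block_mat[of _ n m _ n _ m _ _ m _ n]) auto
  also have "\<dots> * Q = block_diag A D"
    using A D unfolding Q_def by (subst mult_four_block_mat[of _ n m _ n _ m _ _ n _ m]) auto
  finally have "block_diag A D = P * block_diag D A * Q" by simp
  moreover have "P \<in> carrier_mat (n + m) (n + m)" "Q \<in> carrier_mat (n + m) (n + m)"
    unfolding P_def Q_def by (auto intro!: carrier_matI)
  ultimately show ?thesis
    using A D PQ QP by (intro similar_matI[of _ _ P Q "n + m"]) auto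
qed

lemma similar_block_diag:
  assumes "similar_mat A A'" "similar_mat D D'"
  shows "similar_mat (block_diag A D) (block_diag A' D')"
proof -
  from similar_matD[OF assms(1)] obtain n where "A \<in> carrier_mat n n" "A' \<in> carrier_mat n n" by auto
  moreover from similar_matD[OF assms(2)] obtain m
    where "D \<in> carrier_mat m m" "D' \<in> carrier_mat m m" by auto
  ultimately show ?thesis using similar_mat_four_block_0_0[OF assms] by auto
qed

lemma similar_diag_block_mat_permute:
  fixes Bs :: "'a :: comm_ring_1 mat list"
  assumes "mset Bs = mset Cs" and "\<And>B. B \<in> set Bs \<Longrightarrow> square_mat B"
  shows "similar_mat (diag_block_mat Bs) (diag_block_mat Cs)"
  using assms
proof (induct Bs arbitrary: Cs)
  case Nil
  then show ?case by (auto intro!: similar_mat_refl[of _ 0])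
next
  case (Cons B Bs)
  from Cons(2) have "B \<in> set Cs" by (metis list.set_intros(1) set_mset_mset)
  then obtain us vs where Cs: "Cs = us @ B # vs" by (meson split_list)
  from Cons(2) have set: "set Cs = set (B # Bs)" by (metis set_mset_mset)
  then have sq: "\<And>B. B \<in> set Cs \<Longrightarrow> square_mat B" using Cons(3) by auto
  \<comment> \<open>The hypothesis is applied to \<open>vs @ us\<close>, not to
    \<open>us @ vs\<close>: then \<open>us @ B # vs\<close> arises from \<open>B # vs @ us\<close>
    by a single swap of the two blocks made of \<open>B # vs\<close> and \<open>us\<close>.\<close>
  have IH: "similar_mat (diag_block_mat Bs) (diag_block_mat (vs @ us))"
    using Cons(2,3) unfolding Cs by (intro Cons(1)) auto
  have B: "B \<in> carrier_mat (dim_row B) (dim_row B)"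
    using Cons(3)[of B] by (intro carrier_matI) auto
  have "similar_mat (diag_block_mat (B # Bs)) (diag_block_mat (B # vs @ us))"
    using similar_block_diag[OF similar_mat_refl[OF B] IH] by (simp add: Let_def)
  also have "diag_block_mat (B # vs @ us) = block_diag (diag_block_mat (B # vs)) (diag_block_mat us)"
    unfolding append_Cons[symmetric] diag_block_mat_append by (simp add: Let_def)
  finally have "similar_mat (diag_block_mat (B # Bs))
    (block_diag (diag_block_mat (B # vs)) (diag_block_mat us))" .
  moreover have "similar_mat (block_diag (diag_block_mat (B # vs)) (diag_block_mat us))
    (block_diag (diag_block_mat us) (diag_block_mat (B # vs)))"
    by (rule similar_block_diag_swap[OF diag_block_mat_square_carrier diag_block_mat_square_carrier];
        rule sq; auto simp: Cs)
  ultimately show ?case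
    unfolding Cs diag_block_mat_append Let_def by (rule similar_mat_trans)
qed

section \<open>Strict equivalence of pencils\<close>

definition strictly_equivalent ::
    "nat \<Rightarrow> 'a :: field mat \<Rightarrow> 'a mat \<Rightarrow> 'a mat \<Rightarrow> 'a mat \<Rightarrow> bool" where
  "strictly_equivalent n E A E' A' \<longleftrightarrow>
     (\<exists>S \<in> carrier_mat n n. \<exists>T \<in> carrier_mat n n. det S \<noteq> 0 \<and> det T \<noteq> 0 \<and>
        S * E * T = E' \<and> S * A * T = A')"

lemma strictly_equivalentI:
  assumes "S \<in> carrier_mat n n" "T \<in> carrier_mat n n" "det S \<noteq> 0" "det T \<noteq> 0"
    and "S * E * T = E'" "S * A * T = A'"
  shows "strictly_equivalent n E A E' A'"
  using assms unfolding strictly_equivalent_def by blast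

lemma strictly_equivalent_trans:
  assumes EA: "E \<in> carrier_mat n n" "A \<in> carrier_mat n n"
    and 1: "strictly_equivalent n E A E' A'" and 2: "strictly_equivalent n E' A' E'' A''"
  shows "strictly_equivalent n E A E'' A''"
proof -
  from 1 obtain S T where ST: "S \<in> carrier_mat n n" "T \<in> carrier_mat n n" "det S \<noteq> 0" "det T \<noteq> 0"
    "S * E * T = E'" "S * A * T = A'" unfolding strictly_equivalent_def by blast
  from 2 obtain S' T' where ST': "S' \<in> carrier_mat n n" "T' \<in> carrier_mat n n"
    "det S' \<noteq> 0" "det T' \<noteq> 0" "S' * E' * T' = E''" "S' * A' * T' = A''"
    unfolding strictly_equivalent_def by blast
  note assoc = assoc_mult_mat[of _ n n _ n _ n]
  show ?thesis
  proof (rule strictly_equivalentI[of "S' * S" _ "T * T'"])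
    show "S' * S * E * (T * T') = E''"
      using ST(1,2) ST'(1,2) EA unfolding ST'(5)[symmetric] ST(5)[symmetric] by (simp add: assoc)
    show "S' * S * A * (T * T') = A''"
      using ST(1,2) ST'(1,2) EA unfolding ST'(6)[symmetric] ST(6)[symmetric] by (simp add: assoc)
  qed (use ST ST' in \<open>auto simp: det_mult[of _ n]\<close>)
qed

text \<open>Conjugation fixes the identity, so one similarity serves both coefficients. Pencils of
  this shape arise once \<open>E - A\<close> has been normalised to the identity.\<close>

lemma strictly_equivalent_similar:
  assumes B: "B \<in> carrier_mat n n" and sim: "similar_mat B B'"
  shows "strictly_equivalent n B (B - 1\<^sub>m n) B' (B' - 1\<^sub>m n)"
proof -
  from similar_mat_sym[OF sim] obtain P Q where "similar_mat_wit B' B P Q"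
    unfolding similar_mat_def by blast
  moreover have "dim_row B' = n" using similar_matD[OF sim] B by auto
  ultimately have w: "P * Q = 1\<^sub>m n" "B' = P * B * Q" "P \<in> carrier_mat n n" "Q \<in> carrier_mat n n"
    using similar_mat_witD by metis+
  have "P * (B - 1\<^sub>m n) * Q = B' - 1\<^sub>m n"
    using w B by (simp add: mult_minus_distrib_mat[of _ n n _ n] minus_mult_distrib_mat[of _ n n _ _ n])
  then show ?thesis
    using w B det_nonzero_left_inverse[OF w(3,4,1)] by (intro strictly_equivalentI[of P n Q]) auto
qed

text \<open>Coordinate-free form of index at most one for regular pencils: no Jordan chain
  at infinity has length two.\<close>

definition no_chain_at_infinity :: "nat \<Rightarrow> 'a :: field mat \<Rightarrow> 'a mat \<Rightarrow> bool" where
  "no_chain_at_infinity n E A \<longleftrightarrow>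
     (\<forall>u \<in> carrier_vec n. \<forall>w \<in> carrier_vec n.
        E *\<^sub>v u = 0\<^sub>v n \<longrightarrow> E *\<^sub>v w = A *\<^sub>v u \<longrightarrow> u = 0\<^sub>v n)"

text \<open>A chain u, w of the new pencil is carried to the chain T u, T w of the old one, because
  the injective factor \<open>S\<close> cancels on the left.\<close>

lemma no_chain_at_infinity_strictly_equivalent:
  assumes EA: "E \<in> carrier_mat n n" "A \<in> carrier_mat n n"
    and nc: "no_chain_at_infinity n E A" and eq: "strictly_equivalent n E A E' A'"
  shows "no_chain_at_infinity n E' A'"
proof -
  from eq obtain S T where ST: "S \<in> carrier_mat n n" "T \<in> carrier_mat n n" "det S \<noteq> 0" "det T \<noteq> 0"
    "S * E * T = E'" "S * A * T = A'" unfolding strictly_equivalent_def by blast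
  have apply_E: "E' *\<^sub>v v = S *\<^sub>v (E *\<^sub>v (T *\<^sub>v v))" and apply_A: "A' *\<^sub>v v = S *\<^sub>v (A *\<^sub>v (T *\<^sub>v v))"
    if "v \<in> carrier_vec n" for v
    using that ST(1,2) EA unfolding ST(5,6)[symmetric]
    by (simp_all add: assoc_mult_mat_vec[of _ n n _ n])
  have S_inj: "x = y" if "x \<in> carrier_vec n" "y \<in> carrier_vec n" "S *\<^sub>v x = S *\<^sub>v y" for x y
  proof -
    have "S *\<^sub>v (x - y) = 0\<^sub>v n"
      using that ST(1) by (simp add: mult_minus_distrib_mat_vec[of _ n n])
    then have "x - y = 0\<^sub>v n" using det_nonzeroD[OF ST(1,3)] that by auto
    then show "x = y" using that by (auto simp: vec_eq_iff)
  qed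
  show ?thesis unfolding no_chain_at_infinity_def
  proof (intro ballI impI)
    fix u w assume u: "u \<in> carrier_vec n" and w: "w \<in> carrier_vec n"
      and "E' *\<^sub>v u = 0\<^sub>v n" "E' *\<^sub>v w = A' *\<^sub>v u"
    then have *: "S *\<^sub>v (E *\<^sub>v (T *\<^sub>v u)) = S *\<^sub>v 0\<^sub>v n"
      "S *\<^sub>v (E *\<^sub>v (T *\<^sub>v w)) = S *\<^sub>v (A *\<^sub>v (T *\<^sub>v u))"
      using ST(1) unfolding apply_E[OF u] apply_E[OF w] apply_A[OF u] by auto
    have "E *\<^sub>v (T *\<^sub>v u) = 0\<^sub>v n" "E *\<^sub>v (T *\<^sub>v w) = A *\<^sub>v (T *\<^sub>v u)"
      using EA ST(2) u w by (auto intro: S_inj[OF _ _ *(1)] S_inj[OF _ _ *(2)])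
    then have "T *\<^sub>v u = 0\<^sub>v n"
      using nc u w ST(2) unfolding no_chain_at_infinity_def by auto
    then show "u = 0\<^sub>v n" using det_nonzeroD[OF ST(2,4) u] by auto
  qed
qed

section \<open>The Weierstrass form\<close>

lemma pencil_entry:
  assumes "E \<in> carrier_mat n m" "A \<in> carrier_mat n m" "i < n" "j < m"
  shows "pencil E A $$ (i, j) = [:- (A $$ (i, j)), E $$ (i, j):]"
  using assms unfolding pencil_def by (auto simp: monom_Suc monom_0)

lemma pencil_eq_iff:
  assumes "E \<in> carrier_mat n m" "A \<in> carrier_mat n m"
    and "E' \<in> carrier_mat n m" "A' \<in> carrier_mat n m"
  shows "pencil E A = pencil E' A' \<longleftrightarrow> E = E' \<and> A = A'"
proof
  assume eq: "pencil E A = pencil E' A'"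
  have "E $$ (i, j) = E' $$ (i, j) \<and> A $$ (i, j) = A' $$ (i, j)" if "i < n" "j < m" for i j
    using arg_cong[OF eq, of "\<lambda>M. M $$ (i, j)"] that
    unfolding pencil_entry[OF assms(1,2) that] pencil_entry[OF assms(3,4) that] by simp
  then show "E = E' \<and> A = A'" using assms by (auto intro!: eq_matI)
qed simp

lemma pencil_mult:
  assumes S: "S \<in> carrier_mat n n" and E: "E \<in> carrier_mat n n" and A: "A \<in> carrier_mat n n"
    and T: "T \<in> carrier_mat n n"
  shows "map_mat (\<lambda>a. [:a:]) S * pencil E A * map_mat (\<lambda>a. [:a:]) T =
    pencil (S * E * T) (S * A * T)"
proof -
  interpret C: comm_ring_hom "\<lambda>a :: 'a. [:a:]" by unfold_locales auto
  let ?c = "map_mat (\<lambda>a :: 'a. [:a:])"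
  have pencil: "pencil E A = [:0, 1:] \<cdot>\<^sub>m ?c E - ?c A"
    if "E \<in> carrier_mat n n" "A \<in> carrier_mat n n" for E A :: "'a mat"
    using that by (intro eq_matI) (auto simp: pencil_entry pencil_def monom_Suc monom_0)
  have carrier: "?c S \<in> carrier_mat n n" "?c E \<in> carrier_mat n n" "?c A \<in> carrier_mat n n"
    "?c T \<in> carrier_mat n n" using S E A T by auto
  have "?c S * ([:0, 1:] \<cdot>\<^sub>m ?c E - ?c A) * ?c T =
      [:0, 1:] \<cdot>\<^sub>m (?c S * ?c E * ?c T) - ?c S * ?c A * ?c T"
    using carrier
    by (simp add: mult_minus_distrib_mat[of _ n n _ n] minus_mult_distrib_mat[of _ n n _ _ n]
        mult_smult_distrib[of _ n n _ n] mult_smult_assoc_mat[of _ n n _ n])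
  also have "?c S * ?c E * ?c T = ?c (S * E * T)"
    using S E T by (simp add: C.mat_hom_mult[of _ n n _ n])
  also have "?c S * ?c A * ?c T = ?c (S * A * T)"
    using S A T by (simp add: C.mat_hom_mult[of _ n n _ n])
  finally show ?thesis
    using S E A T by (simp add: pencil)
qed

text \<open>Evaluation at \<open>s\<close> is a ring homomorphism and hence commutes with the
  determinant. Besides regularity, tested at s = 1, this provides the polynomial that brings
  similarity from the complex numbers down to the reals.\<close>

lemma poly_det_pencil:
  assumes "E \<in> carrier_mat n n" "A \<in> carrier_mat n n"
  shows "poly (det (pencil E A)) s = det (s \<cdot>\<^sub>m E - A)"
proof -
  have "comm_ring_hom (\<lambda>p. poly p s)" by unfold_locales auto
  note hom_det = comm_ring_hom.hom_det[OF this, of "pencil E A"]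
  have "map_mat (\<lambda>p. poly p s) (pencil E A) = s \<cdot>\<^sub>m E - A"
    using assms by (intro eq_matI) (auto simp: pencil_def poly_monom)
  then show ?thesis using hom_det by simp
qed

lemma jordan_canonical_square:
  assumes "jordan_canonical J"
  shows "J \<in> carrier_mat (dim_row J) (dim_row J)"
proof -
  from assms obtain Bs where J: "J = diag_block_mat Bs"
    and "\<And>B. B \<in> set Bs \<Longrightarrow> (\<exists>k a. B = jordan_block k a) \<or> (\<exists>k a b. B = real_jordan_block k a b)"
    unfolding jordan_canonical_def by blast
  then have "square_mat B" if "B \<in> set Bs" for B
    using that by (force simp: jordan_block_def real_jordan_block_def)
  then show ?thesis unfolding J dim_diag_block_mat(1) by (rule diag_block_mat_square_carrier)
qed

abbreviation nilpotent_jordan :: "nat list \<Rightarrow> 'a :: field mat" where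
  "nilpotent_jordan ks \<equiv> jordan_matrix (map (\<lambda>k. (k, 0)) ks)"

lemma nilpotent_jordan_carrier [simp]:
  "nilpotent_jordan ks \<in> carrier_mat (sum_list ks) (sum_list ks)"
  using jordan_matrix_carrier[of "map (\<lambda>k. (k, 0)) ks"] by (simp add: o_def)

text \<open>Comparing coefficients of s replaces the equation between polynomial matrices by two
  equations over the field, which are what strict equivalence speaks about.\<close>

lemma weierstrass_form_iff:
  assumes E: "E \<in> carrier_mat n n" and A: "A \<in> carrier_mat n n"
  shows "weierstrass_form E A S T J ks \<longleftrightarrow>
     S \<in> carrier_mat n n \<and> det S \<noteq> 0 \<and> T \<in> carrier_mat n n \<and> det T \<noteq> 0 \<and>
     jordan_canonical J \<and> 0 \<notin> set ks \<and> dim_row J + sum_list ks = n \<and>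
     S * E * T = block_diag (1\<^sub>m (dim_row J)) (nilpotent_jordan ks) \<and>
     S * A * T = block_diag J (1\<^sub>m (sum_list ks))"
proof -
  define n0 m where "n0 = dim_row J" and "m = sum_list ks"
  define N :: "'a mat" where "N = nilpotent_jordan ks"
  have N: "N \<in> carrier_mat m m" unfolding N_def m_def by simp
  have "map_mat (\<lambda>a. [:a:]) S * pencil E A * map_mat (\<lambda>a. [:a:]) T =
      four_block_mat (pencil (1\<^sub>m n0) J) (0\<^sub>m n0 m) (0\<^sub>m m n0) (pencil N (1\<^sub>m m)) \<longleftrightarrow>
      S * E * T = block_diag (1\<^sub>m n0) N \<and>
      S * A * T = block_diag J (1\<^sub>m m)"
    if S: "S \<in> carrier_mat n n" and T: "T \<in> carrier_mat n n" and n: "n0 + m = n"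
      and J: "J \<in> carrier_mat n0 n0"
  proof -
    have "four_block_mat (pencil (1\<^sub>m n0) J) (0\<^sub>m n0 m) (0\<^sub>m m n0) (pencil N (1\<^sub>m m)) =
        pencil (block_diag (1\<^sub>m n0) N) (block_diag J (1\<^sub>m m))"
      using J N by (intro eq_matI) (auto simp: pencil_def)
    then show ?thesis
      unfolding pencil_mult[OF S E A T] using S E A T J N n
      by (simp only:) (rule pencil_eq_iff[of _ n n]; auto)
  qed
  note key = this
  have dim: "dim_row E = n" using E by simp
  show ?thesis
  \<comment> \<open>The comparison of coefficients is available only for matching dimensions. If one
    of these conditions fails, both sides of the equivalence are false.\<close>
  proof (cases "S \<in> carrier_mat n n \<and> T \<in> carrier_mat n n \<and> jordan_canonical J \<and> n0 + m = n")
    case True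
    then have "J \<in> carrier_mat n0 n0" unfolding n0_def using jordan_canonical_square by blast
    with True have "invertible_mat S \<longleftrightarrow> det S \<noteq> 0" "invertible_mat T \<longleftrightarrow> det T \<noteq> 0"
      and eq: "S \<in> carrier_mat n n" "T \<in> carrier_mat n n" "n0 + m = n" "J \<in> carrier_mat n0 n0"
      using invertible_mat_iff_det by blast+
    then show ?thesis
      unfolding weierstrass_form_def Let_def dim n0_def[symmetric] m_def[symmetric] N_def[symmetric] key[OF eq]
      by blast
  next
    case False
    then show ?thesis
      unfolding weierstrass_form_def Let_def dim n0_def[symmetric] m_def[symmetric] N_def[symmetric] by blast
  qed
qed

section \<open>Block sizes at infinity\<close>

text \<open>For square \<open>A\<close> this is ker A^2 = ker A, a criterion for the Jordan blocks
  at 0 to have size at most one that does not mention a Jordan form.\<close>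

definition kernel_stable :: "'a :: field mat \<Rightarrow> bool" where
  "kernel_stable A \<longleftrightarrow> (\<forall>v \<in> carrier_vec (dim_col A).
     A *\<^sub>v (A *\<^sub>v v) = 0\<^sub>v (dim_row A) \<longrightarrow> A *\<^sub>v v = 0\<^sub>v (dim_row A))"

lemma kernel_stable_block_diagD:
  assumes A: "A \<in> carrier_mat n n" and D: "D \<in> carrier_mat m m"
    and stable: "kernel_stable (block_diag A D)"
  shows "kernel_stable A" "kernel_stable D"
proof -
  \<comment> \<open>Padding with a zero vector later turns this joint statement into one about each
    block.\<close>
  have split: "A *\<^sub>v a = 0\<^sub>v n \<and> D *\<^sub>v d = 0\<^sub>v m"
    if ad: "a \<in> carrier_vec n" "d \<in> carrier_vec m"
      and "A *\<^sub>v (A *\<^sub>v a) = 0\<^sub>v n" "D *\<^sub>v (D *\<^sub>v d) = 0\<^sub>v m" for a d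
  proof -
    have "block_diag A D *\<^sub>v (block_diag A D *\<^sub>v (a @\<^sub>v d)) = 0\<^sub>v n @\<^sub>v 0\<^sub>v m"
      using that A D by (simp add: mult_mat_vec_split[of _ n _ m])
    moreover have "0\<^sub>v n @\<^sub>v 0\<^sub>v m = (0\<^sub>v (n + m) :: 'a vec)" by (auto simp: append_vec_def)
    ultimately have "block_diag A D *\<^sub>v (a @\<^sub>v d) = 0\<^sub>v n @\<^sub>v 0\<^sub>v m"
      using stable ad A D unfolding kernel_stable_def by auto
    then show ?thesis
      using ad A D by (simp add: mult_mat_vec_split[of _ n _ m] append_vec_eq[of _ n])
  qed
  have "A *\<^sub>v 0\<^sub>v n = 0\<^sub>v n" "D *\<^sub>v 0\<^sub>v m = 0\<^sub>v m"
    using A D by (auto intro!: eq_vecI)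
  note zero = this
  show "kernel_stable A"
    using split[of _ "0\<^sub>v m"] zero A D unfolding kernel_stable_def by auto
  show "kernel_stable D"
    using split[of "0\<^sub>v n"] zero A D unfolding kernel_stable_def by auto
qed

lemma kernel_stable_diag_block_matD:
  assumes "kernel_stable (diag_block_mat Bs)" "\<And>B. B \<in> set Bs \<Longrightarrow> square_mat B" "B \<in> set Bs"
  shows "kernel_stable B"
  using assms
proof (induct Bs)
  case (Cons C Bs)
  have "C \<in> carrier_mat (dim_row C) (dim_row C)"
    using Cons(3)[of C] by (intro carrier_matI) auto
  moreover have "diag_block_mat Bs \<in> carrier_mat (sum_list (map dim_row Bs)) (sum_list (map dim_row Bs))"
    using Cons(3) by (intro diag_block_mat_square_carrier) auto
  moreover have "kernel_stable (block_diag C (diag_block_mat Bs))"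
    using Cons(2) by (simp add: Let_def)
  ultimately have "kernel_stable C" "kernel_stable (diag_block_mat Bs)"
    using kernel_stable_block_diagD by blast+
  then show ?case using Cons by auto
qed auto

lemma kernel_stable_nilpotent_jordan_block:
  assumes stable: "kernel_stable (jordan_block k (0 :: 'a :: field))"
  shows "k \<le> 1"
proof (rule ccontr)
  assume "\<not> k \<le> 1"
  then have k: "0 < k" "1 < k" by auto
  \<comment> \<open>Indices start at 0, so \<open>unit_vec k 1\<close> and
    \<open>unit_vec k 0\<close> are the first two members of the Jordan chain: the block maps the
    former to the latter, and the latter to zero.\<close>
  have 1: "jordan_block k (0 :: 'a) *\<^sub>v unit_vec k 1 = unit_vec k 0"
    using k by (intro eq_vecI) (auto simp: jordan_block_def)
  have 0: "jordan_block k (0 :: 'a) *\<^sub>v unit_vec k 0 = 0\<^sub>v k"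
    using k by (intro eq_vecI) (auto simp: jordan_block_def)
  have "unit_vec k 0 = (0\<^sub>v k :: 'a vec)"
    using stable[unfolded kernel_stable_def, rule_format, of "unit_vec k 1"]
    unfolding 1 using 0 by auto
  then have "(unit_vec k 0 :: 'a vec) $ 0 = 0\<^sub>v k $ 0" by simp
  then show False using k by simp
qed

lemma nilpotent_jordan_kernel_stable:
  assumes "kernel_stable (nilpotent_jordan ks :: 'a :: field mat)" "0 \<notin> set ks" "k \<in> set ks"
  shows "k = 1"
proof -
  have "kernel_stable (jordan_block k (0 :: 'a))"
    using assms(1) by (rule kernel_stable_diag_block_matD[where Bs = "map (\<lambda>(n, a). jordan_block n a) (map (\<lambda>k. (k, 0)) ks)",
          folded jordan_matrix_def]) (use assms(3) in \<open>auto simp: jordan_block_def\<close>)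
  from kernel_stable_nilpotent_jordan_block[OF this] show ?thesis
    using assms(2,3) by (metis less_one nat_less_le)
qed

lemma nilpotent_jordan_ones:
  assumes "\<And>k. k \<in> set ks \<Longrightarrow> k = 1"
  shows "nilpotent_jordan ks = 0\<^sub>m (sum_list ks) (sum_list ks)"
  using assms
proof (induct ks)
  case Nil
  then show ?case by (simp add: jordan_matrix_def)
next
  case (Cons k ks)
  have "jordan_block 1 0 = (0\<^sub>m 1 1 :: 'a mat)"
    by (intro eq_matI) (auto simp: jordan_block_def)
  moreover have "k = 1" using Cons by simp
  ultimately show ?case using Cons by (simp add: jordan_matrix_Cons o_def)
qed

text \<open>If N N v = 0, then u = (0, N v) and w = (0, v) form a chain at infinity of the normal
  form: its leading coefficient kills u and sends w to (0, N v), and its constant coefficient fixes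
  u. Hence N v = 0, and N is kernel stable.\<close>

lemma weierstrass_form_no_chain:
  assumes E: "E \<in> carrier_mat n n" and A: "A \<in> carrier_mat n n"
    and nc: "no_chain_at_infinity n E A"
    and form: "weierstrass_form E A S T J ks" and k: "k \<in> set ks"
  shows "k = 1"
proof -
  define n0 m where "n0 = dim_row J" and "m = sum_list ks"
  define N :: "'a mat" where "N = nilpotent_jordan ks"
  note form' = form[unfolded weierstrass_form_iff[OF E A], folded n0_def m_def N_def]
  have N: "N \<in> carrier_mat m m" unfolding N_def m_def by simp
  have J: "J \<in> carrier_mat n0 n0" using form' jordan_canonical_square unfolding n0_def by blast
  have n: "n = n0 + m" using form' by simp
  have "strictly_equivalent n E A (block_diag (1\<^sub>m n0) N) (block_diag J (1\<^sub>m m))"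
    using form' J N by (intro strictly_equivalentI[of S _ T]) auto
  from no_chain_at_infinity_strictly_equivalent[OF E A nc this]
  have nc': "no_chain_at_infinity n (block_diag (1\<^sub>m n0) N) (block_diag J (1\<^sub>m m))" .
  have zero: "0\<^sub>v n = 0\<^sub>v n0 @\<^sub>v (0\<^sub>v m :: 'a vec)" unfolding n by (auto simp: append_vec_def)
  have J0: "J *\<^sub>v 0\<^sub>v n0 = 0\<^sub>v n0" using J by (auto intro!: eq_vecI)
  have "kernel_stable N" unfolding kernel_stable_def
  proof (intro ballI impI)
    fix v assume "v \<in> carrier_vec (dim_col N)" and NN: "N *\<^sub>v (N *\<^sub>v v) = 0\<^sub>v (dim_row N)"
    with N have v: "v \<in> carrier_vec m" by simp
    have "0\<^sub>v n0 @\<^sub>v (N *\<^sub>v v) = 0\<^sub>v n"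
    proof (rule nc'[unfolded no_chain_at_infinity_def, rule_format])
      show "block_diag (1\<^sub>m n0) N *\<^sub>v (0\<^sub>v n0 @\<^sub>v (N *\<^sub>v v)) = 0\<^sub>v n"
        using N NN v unfolding zero by (simp add: mult_mat_vec_split[of _ n0 _ m])
      show "block_diag (1\<^sub>m n0) N *\<^sub>v (0\<^sub>v n0 @\<^sub>v v) = block_diag J (1\<^sub>m m) *\<^sub>v (0\<^sub>v n0 @\<^sub>v (N *\<^sub>v v))"
        using N J v J0 by (simp add: mult_mat_vec_split[of _ n0 _ m])
    qed (use N v n in auto)
    then show "N *\<^sub>v v = 0\<^sub>v (dim_row N)"
      using N unfolding zero by (simp add: append_vec_eq[of _ n0])
  qed
  then show ?thesis
    using nilpotent_jordan_kernel_stable[of ks k] form' k unfolding N_def by auto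
qed

text \<open>The right-hand side does not mention the form, which is the uniqueness half of the
  definite description. As N vanishes, \<open>det E\<close> is up to nonzero factors the determinant
  of a square zero matrix, and that is 1 exactly when the matrix is empty.\<close>

lemma weierstrass_form_index:
  assumes E: "E \<in> carrier_mat n n" and A: "A \<in> carrier_mat n n"
    and nc: "no_chain_at_infinity n E A" and form: "weierstrass_form E A S T J ks"
  shows "Max (insert 0 (set ks)) = (if det E = 0 then 1 else 0)"
proof -
  note form' = form[unfolded weierstrass_form_iff[OF E A]]
  note ones = weierstrass_form_no_chain[OF E A nc form]
  have N: "nilpotent_jordan ks = (0\<^sub>m (sum_list ks) (sum_list ks) :: 'a mat)"
    using ones by (rule nilpotent_jordan_ones)
  have ST: "S \<in> carrier_mat n n" "T \<in> carrier_mat n n" using form' by auto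
  have "det S * det E * det T = det (S * E * T)"
    using ST E by (simp add: det_mult[of _ n])
  also have "\<dots> = det (0\<^sub>m (sum_list ks) (sum_list ks) :: 'a mat)"
    using form' det_block_diag[OF one_carrier_mat[of "dim_row J"] zero_carrier_mat[of "sum_list ks" "sum_list ks"],
        where 'a = 'a]
    by (simp add: N)
  finally have det: "det S * det E * det T = det (0\<^sub>m (sum_list ks) (sum_list ks) :: 'a mat)" .
  show ?thesis
  proof (cases ks)
    case Nil
    then show ?thesis using det by auto
  next
    case (Cons k ks')
    then have "sum_list ks > 0" using ones[of k] by auto
    then have "det E = 0" using det form' by simp
    moreover have "set ks = {1}" using ones Cons by force
    ultimately show ?thesis by simp
  qed
qed

section \<open>Jordan canonical form over the real or complex field\<close>

text \<open>Unlike conjugation, the relation \<open>A * P = P * B\<close> is linear in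
  \<open>P\<close>. The descent from complex to real similarity relies on this, as it takes linear
  combinations of such \<open>P\<close>.\<close>

lemma similar_matI_det:
  fixes A :: "'a :: field mat"
  assumes A: "A \<in> carrier_mat n n" and B: "B \<in> carrier_mat n n" and P: "P \<in> carrier_mat n n"
    and det: "det P \<noteq> 0" and eq: "A * P = P * B"
  shows "similar_mat A B"
proof -
  obtain Q where Q: "Q \<in> carrier_mat n n" "P * Q = 1\<^sub>m n" "Q * P = 1\<^sub>m n"
    using det_nonzero_obtain_inverse[OF P det] .
  have "A = A * (P * Q)" using A Q by simp
  also have "\<dots> = A * P * Q" using A P Q(1) by (intro assoc_mult_mat[symmetric])
  also have "\<dots> = P * B * Q" unfolding eq ..
  finally show ?thesis using A B P Q by (intro similar_matI[of _ _ P Q n]) auto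
qed

lemma similar_mat_to_detD:
  fixes A :: "'a :: field mat"
  assumes A: "A \<in> carrier_mat n n" and sim: "similar_mat A B"
  obtains P where "B \<in> carrier_mat n n" "P \<in> carrier_mat n n" "det P \<noteq> 0" "A * P = P * B"
proof -
  from sim obtain P Q where "similar_mat_wit A B P Q" unfolding similar_mat_def by blast
  note w = similar_mat_witD2[OF A this]
  have "A * P = P * B * (Q * P)"
    using w(5-7) unfolding w(3) by (simp add: assoc_mult_mat[of _ n n _ n _ n])
  then have "A * P = P * B" using w(2,5-7) by simp
  then show thesis using that w det_nonzero_left_inverse[OF w(6,7,1)] by blast
qed

section \<open>Similarity over the scalar field and over the complex numbers\<close>

lemma to_complex_zero: "to_complex 0 = 0"
  using to_complex_add[of 0 0] by simp

lemma to_complex_uminus: "to_complex (- a) = - to_complex a"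
  using to_complex_add[of "- a" a] by (simp add: to_complex_zero eq_neg_iff_add_eq_0)

interpretation to_complex: field_hom "to_complex :: 'a :: real_or_complex \<Rightarrow> complex"
  by unfold_locales
    (auto simp: to_complex_zero to_complex_one to_complex_add to_complex_mult to_complex_uminus)

abbreviation complexify :: "'a :: real_or_complex mat \<Rightarrow> complex mat" where
  "complexify \<equiv> map_mat to_complex"

lemma complexify_obtain:
  assumes "M \<in> carrier_mat n m"
    and "\<And>i j. i < n \<Longrightarrow> j < m \<Longrightarrow> M $$ (i, j) \<in> range (to_complex :: 'a :: real_or_complex \<Rightarrow> complex)"
  obtains M' :: "'a :: real_or_complex mat" where "M' \<in> carrier_mat n m" "M = complexify M'"
proof
  show "map_mat (inv_into UNIV (to_complex :: 'a \<Rightarrow> complex)) M \<in> carrier_mat n m" using assms(1) by simp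
  show "M = complexify (map_mat (inv_into UNIV (to_complex :: 'a \<Rightarrow> complex)) M)"
    using assms by (intro eq_matI) (auto simp: f_inv_into_f)
qed

lemma complexify_intertwiner:
  fixes A B P :: "'a :: real_or_complex mat"
  assumes "A \<in> carrier_mat n n" "B \<in> carrier_mat n n" "P \<in> carrier_mat n n"
    and "complexify A * complexify P = complexify P * complexify B"
  shows "A * P = P * B"
proof -
  have "complexify (A * P) = complexify (P * B)"
    using assms by (simp add: to_complex.mat_hom_mult[of _ n n _ n])
  then show ?thesis by (rule to_complex.mat_hom_inj)
qed

text \<open>If \<open>P\<close> intertwines two real matrices, so do \<open>X = P + cnj P\<close> and
  \<open>Y = \<i> (P - cnj P)\<close>, which are real; as \<open>X + s Y = 2 P\<close> for \<open>s = - \<i>\<close>, the polynomial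
  \<open>det (X + s Y)\<close> is not zero, so that \<open>X + s Y\<close> is invertible for some real \<open>s\<close>.\<close>

lemma similar_mat_complexifyD:
  fixes A B :: "'a :: real_or_complex mat"
  assumes A: "A \<in> carrier_mat n n" and B: "B \<in> carrier_mat n n"
    and sim: "similar_mat (complexify A) (complexify B)"
  shows "similar_mat A B"
proof -
  define hA hB where "hA = complexify A" and "hB = complexify B"
  have hA: "hA \<in> carrier_mat n n" and hB: "hB \<in> carrier_mat n n"
    using A B unfolding hA_def hB_def by auto
  obtain P where P: "P \<in> carrier_mat n n" "det P \<noteq> 0" "hA * P = P * hB"
    using similar_mat_to_detD[OF _ sim] A unfolding hA_def hB_def by auto
  from range_to_complex[where 'a = 'a] show ?thesis
  proof
    assume "range (to_complex :: 'a \<Rightarrow> complex) = UNIV"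
    then obtain P' :: "'a mat" where P': "P' \<in> carrier_mat n n" "P = complexify P'"
      using complexify_obtain[OF P(1)] by blast
    have "A * P' = P' * B"
      using P(3) unfolding P'(2) hA_def hB_def by (rule complexify_intertwiner[OF A B P'(1)])
    then show ?thesis
      using A B P(2) P' by (intro similar_matI_det[of _ n _ P']) auto
  next
    assume real: "range (to_complex :: 'a \<Rightarrow> complex) = \<real>"
    have cnj: "comm_ring_hom cnj" by unfold_locales auto
    note cnj_mult = semiring_hom.mat_hom_mult[OF comm_ring_hom.axioms(1)[OF cnj, THEN ring_hom.axioms(1)]]
    have [simp]: "cnj (to_complex a) = to_complex a" for a :: 'a
      using real by (metis Reals_cnj_iff rangeI)
    define P' where "P' = map_mat cnj P"
    have P': "P' \<in> carrier_mat n n" using P unfolding P'_def by simp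
    have "map_mat cnj hA = hA" "map_mat cnj hB = hB"
      unfolding hA_def hB_def by (auto intro!: eq_matI)
    \<comment> \<open>Both given matrices have real entries, so conjugating the intertwining
      relation changes only \<open>P\<close>.\<close>
    then have PB': "hA * P' = P' * hB"
      using P hA hB unfolding P'_def by (metis cnj_mult)
    define X Y where "X = P + P'" and "Y = \<i> \<cdot>\<^sub>m (P - P')"
    have X: "X \<in> carrier_mat n n" and Y: "Y \<in> carrier_mat n n"
      using P P' unfolding X_def Y_def by auto
    have AX: "hA * X = X * hB"
      using P P' PB' hA hB unfolding X_def
      by (simp add: mult_add_distrib_mat[of _ n n _ n] add_mult_distrib_mat[of _ n n _ _ n])
    have W: "P - P' \<in> carrier_mat n n" using P' by (rule minus_carrier_mat)
    have "hA * (P - P') = (P - P') * hB"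
      using P P' PB' hA hB
      by (simp add: mult_minus_distrib_mat[of _ n n _ n] minus_mult_distrib_mat[of _ n n _ _ n])
    then have AY: "hA * Y = Y * hB"
      unfolding Y_def mult_smult_distrib[OF hA W] mult_smult_assoc_mat[OF W hB] by simp
    have "X $$ (i, j) \<in> range (to_complex :: 'a \<Rightarrow> complex)" if "i < n" "j < n" for i j
      using that P unfolding real X_def P'_def by (auto simp: Reals_cnj_iff add.commute)
    then obtain X' :: "'a mat" where X': "X' \<in> carrier_mat n n" "X = complexify X'"
      using complexify_obtain[OF X] by blast
    have "Y $$ (i, j) \<in> range (to_complex :: 'a \<Rightarrow> complex)" if "i < n" "j < n" for i j
      using that P unfolding real Y_def P'_def by (auto simp: Reals_cnj_iff algebra_simps)
    then obtain Y' :: "'a mat" where Y': "Y' \<in> carrier_mat n n" "Y = complexify Y'"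
      using complexify_obtain[OF Y] by blast
    \<comment> \<open>The sign compensates for the convention s E - A of pencils.\<close>
    define p where "p = det (pencil Y (- X))"
    have p: "poly p s = det (s \<cdot>\<^sub>m Y + X)" for s
    proof -
      have "s \<cdot>\<^sub>m Y - - X = s \<cdot>\<^sub>m Y + X" using X Y by (intro eq_matI) auto
      then show ?thesis unfolding p_def using X Y by (simp add: poly_det_pencil[of _ n])
    qed
    have "(- \<i>) \<cdot>\<^sub>m Y + X = 2 \<cdot>\<^sub>m P"
      using P P' unfolding X_def Y_def by (intro eq_matI) (auto simp: algebra_simps)
    then have "poly p (- \<i>) \<noteq> 0" unfolding p using P by simp
    then have "p \<noteq> 0" by auto
    then have "finite {s. poly p s = 0}" by (rule poly_roots_finite)
    moreover have "infinite (range complex_of_real)"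
      using finite_imageD[OF _ inj_of_real] infinite_UNIV_char_0 by blast
    ultimately obtain r where r: "poly p (complex_of_real r) \<noteq> 0"
      by (metis (mono_tags, lifting) finite_subset image_subsetI mem_Collect_eq)
    have "complex_of_real r \<in> range (to_complex :: 'a \<Rightarrow> complex)" unfolding real by simp
    then obtain c :: 'a where c: "complex_of_real r = to_complex c" by auto
    define Z where "Z = c \<cdot>\<^sub>m Y' + X'"
    have Z: "Z \<in> carrier_mat n n" using X' Y' unfolding Z_def by simp
    have hZ: "complexify Z = to_complex c \<cdot>\<^sub>m Y + X"
      unfolding Z_def X' Y' using X'(1) Y'(1)
      by (intro eq_matI) (auto simp: to_complex_add to_complex_mult)
    have "to_complex (det Z) \<noteq> 0"
      using r unfolding p c hZ[symmetric] by simp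
    then have "det Z \<noteq> 0" by auto
    moreover have "hA * complexify Z = complexify Z * hB"
      unfolding hZ using X Y hA hB AX AY
      by (simp add: mult_add_distrib_mat[of _ n n _ n] add_mult_distrib_mat[of _ n n _ _ n]
          mult_smult_distrib[of _ n n _ n] mult_smult_assoc_mat[of _ n n _ n])
    then have "A * Z = Z * B"
      unfolding hA_def hB_def by (rule complexify_intertwiner[OF A B Z])
    ultimately show ?thesis using A B Z by (intro similar_matI_det[of _ n _ Z])
  qed
qed

section \<open>Real Jordan blocks over the complex numbers\<close>

text \<open>Computes products with matrices that have at most two nonzero entries per column, such
  as \<open>P\<close> and \<open>J\<close> in the next similarity. The deltas are added rather than
  separated by cases, so \<open>x = y\<close> is allowed; this occurs for the positions
  \<open>j\<close> and \<open>j - 1\<close> when \<open>j = 0\<close>.\<close>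

lemma sum_two_deltas:
  fixes f :: "nat \<Rightarrow> 'a :: comm_ring_1"
  assumes "x < n" "y < n"
  shows "(\<Sum>l = 0..<n. f l * ((if l = x then \<alpha> else 0) + (if l = y then \<beta> else 0))) = f x * \<alpha> + f y * \<beta>"
  using assms by (simp add: distrib_left sum.distrib if_distrib[where f = "(*) _"] sum.delta cong: if_cong)

text \<open>The change of basis consists of the eigenvector chains \<open>e\<^sub>2\<^sub>j + \<i> e\<^sub>2\<^sub>j\<^sub>+\<^sub>1\<close> for \<open>a + \<i> b\<close>
  and \<open>e\<^sub>2\<^sub>j - \<i> e\<^sub>2\<^sub>j\<^sub>+\<^sub>1\<close> for \<open>a - \<i> b\<close>.\<close>

lemma real_jordan_block_similar:
  fixes a b :: complex
  shows "similar_mat (real_jordan_block k a b)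
    (jordan_matrix [(k, a + \<i> * b), (k, a - \<i> * b)])"
proof -
  \<comment> \<open>Columns below \<open>k\<close> form the chain for \<open>a + \<i> * b\<close>,
    the others the chain for \<open>a - \<i> * b\<close>; \<open>j' j\<close> is the place of column
    \<open>j\<close> in its chain, and \<open>a + e j * b\<close> is its eigenvalue.\<close>
  define j' where "j' j = (if j < k then j else j - k)" for j :: nat
  define e where "e j = (if j < k then \<i> else - \<i>)" for j :: nat
  define P where "P = mat (2 * k) (2 * k) (\<lambda>(i, j).
    (if i = 2 * j' j then 1 else 0) + (if i = 2 * j' j + 1 then e j else 0))"
  \<comment> \<open>Half the adjoint of \<open>P\<close>: the columns of \<open>P\<close> are
    orthogonal with squared norm 2, and the conjugate of \<open>e j\<close> is
    \<open>- e j\<close>.\<close>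
  define Q where "Q = mat (2 * k) (2 * k) (\<lambda>(j, i).
    (if i = 2 * j' j then 1 / 2 else 0) + (if i = 2 * j' j + 1 then - e j / 2 else 0))"
  \<comment> \<open>The Jordan matrix, written with two deltas per column. The superdiagonal entry
    is switched off in columns 0 and \<open>k\<close>, where the chains begin; this also makes the
    truncated \<open>j - 1\<close> harmless at \<open>j = 0\<close>.\<close>
  define J where "J = mat (2 * k) (2 * k) (\<lambda>(l, j).
    (if l = j then a + e j * b else 0) + (if l = j - 1 then if j = 0 \<or> j = k then 0 else 1 else 0))"
  define R where "R = real_jordan_block k a b"
  have carrier: "P \<in> carrier_mat (2 * k) (2 * k)" "Q \<in> carrier_mat (2 * k) (2 * k)"
    "J \<in> carrier_mat (2 * k) (2 * k)" "R \<in> carrier_mat (2 * k) (2 * k)"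
    unfolding P_def Q_def J_def R_def real_jordan_block_def by auto
  have j': "2 * j' j < 2 * k" "2 * j' j + 1 < 2 * k" if "j < 2 * k" for j
    using that unfolding j'_def by auto
  have mult_P: "(M * P) $$ (i, j) = M $$ (i, 2 * j' j) + M $$ (i, 2 * j' j + 1) * e j"
    if "M \<in> carrier_mat (2 * k) (2 * k)" "i < 2 * k" "j < 2 * k" for M i j
    using that sum_two_deltas[OF j'[OF that(3)], of "\<lambda>l. M $$ (i, l)" 1 "e j"]
    by (auto simp: P_def scalar_prod_def intro!: sum.cong)
  have mult_J: "(P * J) $$ (i, j) = P $$ (i, j) * (a + e j * b) +
      P $$ (i, j - 1) * (if j = 0 \<or> j = k then 0 else 1)"
    if "i < 2 * k" "j < 2 * k" for i j
    using that carrier sum_two_deltas[of j "2 * k" "j - 1" "\<lambda>l. P $$ (i, l)"]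
    by (auto simp: J_def scalar_prod_def)
  have "Q * P = 1\<^sub>m (2 * k)"
  proof (rule eq_matI)
    fix i j assume "i < dim_row (1\<^sub>m (2 * k))" "j < dim_col (1\<^sub>m (2 * k))"
    then have ij: "i < 2 * k" "j < 2 * k" by auto
    show "(Q * P) $$ (i, j) = 1\<^sub>m (2 * k) $$ (i, j)"
      using ij j'[OF ij(2)] unfolding mult_P[OF carrier(2) ij]
      by (cases "i < k"; cases "j < k") (auto simp: Q_def j'_def e_def)
  qed (use carrier in auto)
  then have "det P \<noteq> 0" using carrier det_nonzero_left_inverse by blast
  moreover have "R * P = P * J"
  proof (rule eq_matI)
    fix i j assume "i < dim_row (P * J)" "j < dim_col (P * J)"
    then have ij: "i < 2 * k" "j < 2 * k" using carrier by auto
    obtain q s where i: "i = 2 * q + s" and s: "s = 0 \<or> s = 1" 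
      by (metis div_mult_mod_eq mult.commute parity_cases)
    have div: "i div 2 = q" "(2 * j' j + 1) div 2 = j' j" using i s by auto
    have R: "R $$ (i, l) = (if i div 2 = l div 2 then (if i = l then a else if i < l then b else - b)
     else if l = i + 2 then 1 else 0)" if "l < 2 * k" for l
      using that ij unfolding R_def real_jordan_block_def by simp
    have P: "P $$ (i, l) = (if i = 2 * j' l then 1 else 0) + (if i = 2 * j' l + 1 then e l else 0)"
      if "l < 2 * k" for l
      using that ij unfolding P_def by simp
    have j1: "j - 1 < 2 * k" using ij by simp
    have j'1: "j' (j - 1) = j' j - 1 \<and> e (j - 1) = e j \<and> j' j > 0" if "j \<noteq> 0" "j \<noteq> k"
      using that ij unfolding j'_def e_def by auto
    have j'0: "j' j = 0" if "j = 0 \<or> j = k" using that unfolding j'_def by auto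
    have ee: "e l * e l = - 1" for l unfolding e_def by simp
    have eeb: "e j * (e j * b) = - b" "b * (e j * e j) = - b"
      using ee[of j] by (simp_all flip: mult.assoc)
    note entries = mult_P[OF carrier(4) ij] mult_J[OF ij] R[OF j'(1)[OF ij(2)]]
      R[OF j'(2)[OF ij(2)]] P[OF ij(2)] P[OF j1] div
    show "(R * P) $$ (i, j) = (P * J) $$ (i, j)"
    \<comment> \<open>Heads of chains are eigenvectors; every other column has a predecessor in its
      own chain.\<close>
    proof (cases "j = 0 \<or> j = k")
      case True
      with i s show ?thesis
        unfolding entries by (auto simp: j'0 eeb distrib_left distrib_right mult.assoc mult.commute[of b])
    next
      case False
      then have "j' (j - 1) = j' j - 1" "e (j - 1) = e j" "0 < j' j" using j'1 by auto
      moreover from this obtain u where "j' j = Suc u" by (cases "j' j") auto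
      ultimately have u: "j' j = Suc u" "j' (j - 1) = u" "e (j - 1) = e j" by auto
      from s False show ?thesis
        unfolding entries unfolding u i by (auto simp: eeb algebra_simps)
    qed
  qed (use carrier in auto)
  ultimately have "similar_mat R J" using carrier by (intro similar_matI_det[of _ "2 * k" _ P])
  also have "J = jordan_matrix [(k, a + \<i> * b), (k, a - \<i> * b)]"
  proof -
    have "jordan_matrix [(k, a + \<i> * b), (k, a - \<i> * b)] =
        block_diag (jordan_block k (a + \<i> * b)) (jordan_block k (a - \<i> * b))"
      unfolding jordan_matrix_def list.map case_prod_conv diag_block_mat.simps(2)[of _ "[_]"]
        diag_block_mat_singleton Let_def ..
    also have "\<dots> = J"
    proof (rule eq_matI)
      fix i j assume "i < dim_row J" "j < dim_col J"
      then have ij: "i < 2 * k" "j < 2 * k" using carrier by auto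
      show "block_diag (jordan_block k (a + \<i> * b)) (jordan_block k (a - \<i> * b)) $$ (i, j) = J $$ (i, j)"
        using ij by (cases "i < k"; cases "j < k") (auto simp: J_def e_def jordan_block_def)
    qed (use carrier in \<open>auto simp: jordan_block_def\<close>)
    finally show ?thesis ..
  qed
  finally show ?thesis unfolding R_def .
qed

lemma map_diag_block_mat:
  assumes "f 0 = 0"
  shows "map_mat f (diag_block_mat Bs) = diag_block_mat (map (map_mat f) Bs)"
proof (induct Bs)
  case (Cons B Bs)
  have "map_mat f (diag_block_mat (B # Bs)) =
      block_diag (map_mat f B) (map_mat f (diag_block_mat Bs))"
    using assms by (intro eq_matI) (auto simp: Let_def)
  then show ?case unfolding Cons by (simp add: Let_def)
qed (auto simp: assms)

lemma complexify_jordan_block: "complexify (jordan_block k a) = jordan_block k (to_complex a)"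
  by (intro eq_matI) (auto simp: jordan_block_def)

lemma complexify_real_jordan_block:
  "complexify (real_jordan_block k a b) = real_jordan_block k (to_complex a) (to_complex b)"
  by (intro eq_matI) (auto simp: real_jordan_block_def to_complex_uminus)

lemma complexify_jordan_matrix:
  "complexify (jordan_matrix ns) = jordan_matrix (map (\<lambda>(k, a). (k, to_complex a)) ns)"
  unfolding jordan_matrix_def
  by (simp add: map_diag_block_mat case_prod_unfold o_def complexify_jordan_block)

section \<open>Jordan canonical form over the scalar field\<close>

text \<open>For each positive size and each eigenvalue the number of blocks can be computed from
  \<open>A\<close> alone, and \<open>jordan_nf\<close> excludes blocks of size 0.\<close>

lemma jordan_nf_mset_unique:
  assumes 1: "jordan_nf (A :: complex mat) ns" and 2: "jordan_nf A ms"
  shows "mset ns = mset ms"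
proof (rule multiset_eqI)
  fix ka :: "nat \<times> complex"
  obtain k a where ka: "ka = (k, a)" by force
  have count: "count (mset xs) x = length (filter ((=) x) xs)" for xs and x :: "nat \<times> complex"
    by (induct xs) auto
  show "count (mset ns) ka = count (mset ms) ka"
  proof (cases "k = 0")
    case True
    then show ?thesis using 1 2 unfolding jordan_nf_def ka
      by (metis count_mset_0_iff fst_conv imageI)
  next
    case False
    show ?thesis
      unfolding count ka
      using compute_nr_of_jordan_blocks[OF 1 False, of a] compute_nr_of_jordan_blocks[OF 2 False, of a]
      by (rule trans[OF sym])
  qed
qed

lemma jordan_canonical_exists:
  fixes A :: "'a :: real_or_complex mat"
  assumes A: "A \<in> carrier_mat n n"
  shows "\<exists>J. jordan_canonical J \<and> similar_mat A J"
proof -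
  have hA: "complexify A \<in> carrier_mat n n" using A by simp
  obtain as where "char_poly (complexify A) = (\<Prod>a\<leftarrow>as. [:- a, 1:])"
    using char_poly_factorized[OF hA] by blast
  then obtain js where js: "jordan_nf (complexify A) js"
    using jordan_nf_exists[OF hA] by blast
  then have pos: "0 \<notin> fst ` set js" and sim: "similar_mat (complexify A) (jordan_matrix js)"
    unfolding jordan_nf_def by auto
  from pos have pos: "0 < k" if "(k, a) \<in> set js" for k a using that by force
  \<comment> \<open>Since similarity descends along \<open>complexify\<close>, it remains to find a
    canonical matrix over the field with the right complexification up to similarity.\<close>
  have suff: ?thesis if "jordan_canonical J" "similar_mat (complexify J) (jordan_matrix js)"
    for J :: "'a mat"
  proof -
    have sim': "similar_mat (complexify A) (complexify J)"
      using similar_mat_trans[OF sim similar_mat_sym[OF that(2)]] .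
    from similar_matD[OF sim'] obtain m where "complexify A \<in> carrier_mat m m"
      "complexify J \<in> carrier_mat m m" by blast
    then have dim: "dim_row J = n" using A by auto
    have "J \<in> carrier_mat n n" using jordan_canonical_square[OF that(1)] unfolding dim .
    from similar_mat_complexifyD[OF A this sim'] show ?thesis using that(1) by auto
  qed
  define g where "g = inv_into UNIV (to_complex :: 'a \<Rightarrow> complex)"
  have g: "to_complex (g z) = z" if "z \<in> range (to_complex :: 'a \<Rightarrow> complex)" for z
    unfolding g_def using that by (rule f_inv_into_f)
  from range_to_complex[where 'a = 'a] show ?thesis
  proof
    assume "range (to_complex :: 'a \<Rightarrow> complex) = UNIV"
    then have g: "to_complex (g z) = z" for z using g by simp
    define J where "J = jordan_matrix (map (\<lambda>(k, a). (k, g a)) js)"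
    have "jordan_canonical J"
      unfolding jordan_canonical_def
    proof (intro exI conjI ballI)
      show "J = diag_block_mat (map (\<lambda>(k, a). jordan_block k (g a)) js)"
        unfolding J_def jordan_matrix_def by (simp add: case_prod_unfold o_def)
    next
      fix B assume "B \<in> set (map (\<lambda>(k, a). jordan_block k (g a)) js)"
      then obtain k a where "(k, a) \<in> set js" "B = jordan_block k (g a)" by auto
      then show "(\<exists>k a. 0 < k \<and> B = jordan_block k a) \<or> range (to_complex :: 'a \<Rightarrow> complex) = \<real> \<and>
          (\<exists>k a b. 0 < k \<and> 0 < b \<and> B = real_jordan_block k a b)"
        using pos by blast
    qed
    moreover have "complexify J = jordan_matrix js"
      unfolding J_def complexify_jordan_matrix by (simp add: g case_prod_unfold o_def)
    ultimately show ?thesis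
      using suff[of J] similar_mat_refl[OF jordan_matrix_carrier[of js]] by metis
  next
    assume real: "range (to_complex :: 'a \<Rightarrow> complex) = \<real>"
    then have g: "to_complex (g (complex_of_real r)) = complex_of_real r" for r using g by simp
    have [simp]: "cnj (to_complex a) = to_complex a" for a :: 'a
      using real by (metis Reals_cnj_iff rangeI)
    define c where "c = (\<lambda>(k :: nat, a). (k, cnj a))"
    \<comment> \<open>\<open>complexify A\<close> equals its own conjugate, so conjugating its
      similarity to \<open>jordan_matrix js\<close> yields a second Jordan form with conjugate
      eigenvalues.\<close>
    have "jordan_nf (complexify A) (map c js)"
    proof -
      interpret cnj: comm_ring_hom cnj by unfold_locales auto
      from sim obtain P Q where "similar_mat_wit (complexify A) (jordan_matrix js) P Q"
        unfolding similar_mat_def by blast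
      note w = similar_mat_witD2[OF hA this]
      have "map_mat cnj (complexify A) = complexify A" by (auto intro!: eq_matI)
      moreover have "map_mat cnj (jordan_matrix js) = jordan_matrix (map c js)"
      proof -
        have "map_mat cnj (jordan_block k a) = jordan_block k (cnj a)" for k a
          by (intro eq_matI) (auto simp: jordan_block_def)
        then show ?thesis unfolding jordan_matrix_def c_def
          by (simp add: map_diag_block_mat case_prod_unfold o_def)
      qed
      moreover from this have "jordan_matrix (map c js) \<in> carrier_mat n n"
        using map_carrier_mat[of cnj "jordan_matrix js"] w(5) by simp
      ultimately have "similar_mat_wit (complexify A) (jordan_matrix (map c js))
          (map_mat cnj P) (map_mat cnj Q)"
        using w(4-7) cnj.mat_hom_mult[OF w(6,7)] cnj.mat_hom_mult[OF w(7,6)]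
          cnj.mat_hom_mult[OF mult_carrier_mat[OF w(6,5)] w(7)] cnj.mat_hom_mult[OF w(6,5)]
        unfolding w(1,2) w(3)[symmetric] cnj.mat_hom_one
        by (intro similar_mat_witI[of _ _ n]) auto
      moreover have "0 \<notin> fst ` set (map c js)" using pos unfolding c_def by fastforce
      ultimately show ?thesis unfolding jordan_nf_def similar_mat_def by blast
    qed
    from jordan_nf_mset_unique[OF js this] have sym: "mset js = image_mset c (mset js)" by simp
    define R where "R = filter (\<lambda>(k, a). Im a = 0) js"
    define U where "U = filter (\<lambda>(k, a). Im a > 0) js"
    define L where "L = filter (\<lambda>(k, a). Im a < 0) js"
    have "mset js = mset R + mset U + mset L"
      unfolding R_def U_def L_def by (induct js) auto
    \<comment> \<open>Filtering a conjugation-invariant multiset for negative imaginary part amounts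
      to conjugating its part with positive imaginary part.\<close>
    moreover have "mset L = image_mset c (mset U)"
    proof -
      have "mset L = filter_mset (\<lambda>(k, a). Im a < 0) (image_mset c (mset js))"
        unfolding L_def mset_filter sym[symmetric] ..
      also have "\<dots> = image_mset c (mset U)"
        unfolding U_def mset_filter filter_mset_image_mset
        by (rule arg_cong[where f = "image_mset c"], rule filter_mset_cong) (auto simp: c_def)
      finally show ?thesis .
    qed
    ultimately have parts: "mset js = mset R + mset U + image_mset c (mset U)" by simp
    \<comment> \<open>The same blocks, reordered so that each eigenvalue in the upper half plane is
      followed by its conjugate.\<close>
    define js' where "js' = concat (map (\<lambda>x. [x]) R @ map (\<lambda>x. [x, c x]) U)"
    have "mset js' = mset js" unfolding parts js'_def by (induct R; induct U) auto
    then have sim_js: "similar_mat (jordan_matrix js') (jordan_matrix js)"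
      unfolding jordan_matrix_def by (intro similar_diag_block_mat_permute) auto
    \<comment> \<open>Each block over the reals is listed together with the complex Jordan matrix it
      becomes, so that similarity can be proved block by block.\<close>
    define Ms :: "('a mat \<times> complex mat) list" where
      "Ms = map (\<lambda>(k, a). (jordan_block k (g (Re a)), jordan_matrix [(k, a)])) R @
        map (\<lambda>(k, a). (real_jordan_block k (g (Re a)) (g (Im a)), jordan_matrix [(k, a), c (k, a)])) U"
    define J where "J = diag_block_mat (map fst Ms)"
    have "0 < g (Im a)" if "0 < Im a" for a
    proof -
      have "g (Im a) \<noteq> 0" using g[of "Im a"] that by auto
      moreover have "0 \<le> g (Im a)"
        using that by (subst to_complex_less_eq) (simp add: g less_eq_complex_def)
      ultimately show ?thesis by (simp add: less_le)
    qed
    note posb = this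
    have "jordan_canonical J" unfolding jordan_canonical_def
    proof (intro exI conjI ballI)
      show "J = diag_block_mat (map fst Ms)" unfolding J_def ..
    next
      fix B assume "B \<in> set (map fst Ms)"
      then consider k a where "(k, a) \<in> set R" "B = jordan_block k (g (Re a))"
        | k a where "(k, a) \<in> set U" "B = real_jordan_block k (g (Re a)) (g (Im a))"
        unfolding Ms_def by auto
      then show "(\<exists>k a. 0 < k \<and> B = jordan_block k a) \<or> range (to_complex :: 'a \<Rightarrow> complex) = \<real> \<and>
          (\<exists>k a b. 0 < k \<and> 0 < b \<and> B = real_jordan_block k a b)"
      proof cases
        case (1 k a)
        then have "0 < k" using pos unfolding R_def by auto
        with 1 show ?thesis by blast
      next
        case (2 k a)
        then have "0 < k" "0 < g (Im a)" using pos posb unfolding U_def by auto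
        with 2 real show ?thesis by blast
      qed
    qed
    moreover have "similar_mat (complexify J) (jordan_matrix js')"
    proof -
      have "similar_mat (complexify B) C" if BC: "(B, C) \<in> set Ms" for B C
      proof -
        from BC consider (real) k a where "(k, a) \<in> set R" "B = jordan_block k (g (Re a))"
            "C = jordan_matrix [(k, a)]"
          | (upper) k a where "(k, a) \<in> set U" "B = real_jordan_block k (g (Re a)) (g (Im a))"
            "C = jordan_matrix [(k, a), c (k, a)]"
          unfolding Ms_def by auto
        then show ?thesis
        proof cases
          case real
          then have "complex_of_real (Re a) = a" unfolding R_def by (auto simp: complex_eq_iff)
          then have "complexify B = C"
            unfolding real complexify_jordan_block g jordan_matrix_def list.map case_prod_conv
              diag_block_mat_singleton by simp
          then show ?thesis unfolding real using similar_mat_refl[OF jordan_matrix_carrier] by simp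
        next
          case upper
          have "c (k, a) = (k, complex_of_real (Re a) - \<i> * complex_of_real (Im a))"
            "a = complex_of_real (Re a) + \<i> * complex_of_real (Im a)"
            by (auto simp: c_def complex_eq_iff)
          then show ?thesis
            unfolding upper complexify_real_jordan_block g
            using real_jordan_block_similar[of k "complex_of_real (Re a)" "complex_of_real (Im a)"]
            by simp
        qed
      qed
      then have "similar_mat (diag_block_mat (map fst (map (map_prod complexify id) Ms)))
          (diag_block_mat (map snd (map (map_prod complexify id) Ms)))"
        by (intro similar_diag_mat_block_mat) auto
      moreover have "map snd Ms = map jordan_matrix (map (\<lambda>x. [x]) R @ map (\<lambda>x. [x, c x]) U)"
        unfolding Ms_def by auto
      ultimately show ?thesis
        unfolding J_def js'_def jordan_matrix_concat_diag_block_mat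
        by (simp add: map_diag_block_mat o_def)
    qed
    ultimately show ?thesis using suff similar_mat_trans[OF _ sim_js] by blast
  qed
qed

section \<open>Existence of the Weierstrass form\<close>

lemma det_diag_block_mat:
  fixes Bs :: "'a :: idom mat list"
  assumes "\<And>B. B \<in> set Bs \<Longrightarrow> square_mat B"
  shows "det (diag_block_mat Bs) = prod_list (map det Bs)"
  using assms
proof (induct Bs)
  case (Cons B Bs)
  have "B \<in> carrier_mat (dim_row B) (dim_row B)"
    using Cons(2)[of B] by (intro carrier_matI) auto
  moreover have "diag_block_mat Bs \<in> carrier_mat (sum_list (map dim_row Bs)) (sum_list (map dim_row Bs))"
    using Cons(2) by (intro diag_block_mat_square_carrier) auto
  ultimately have "det (block_diag B (diag_block_mat Bs)) = det B * det (diag_block_mat Bs)"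
    by (rule det_block_diag)
  then show ?case using Cons by (simp add: Let_def)
qed simp

lemma diag_block_mat_zero:
  assumes "\<And>B. B \<in> set Bs \<Longrightarrow> B = 0\<^sub>m (dim_row B) (dim_row B)"
  shows "diag_block_mat Bs = 0\<^sub>m (sum_list (map dim_row Bs)) (sum_list (map dim_row Bs))"
  using assms
proof (induct Bs)
  case (Cons B Bs)
  obtain d where "B = 0\<^sub>m d d" using Cons(2)[of B] by auto
  then show ?case using Cons by (simp add: Let_def)
qed simp

lemma det_jordan_block: "det (jordan_block k (a :: 'a :: idom)) = a ^ k"
proof -
  have "upper_triangular (jordan_block k a)" by (auto simp: jordan_block_def)
  moreover have "diag_mat (jordan_block k a) = replicate k a"
    by (intro nth_equalityI) (auto simp: diag_mat_def jordan_block_def)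
  ultimately show ?thesis using det_upper_triangular[OF _ jordan_block_carrier, of k a] by simp
qed

text \<open>Over the complex numbers the determinant is (r + i s)^k (r - i s)^k with r, s real and s
  nonzero. The singular blocks of a canonical form are therefore ordinary Jordan blocks at
  0.\<close>

lemma det_real_jordan_block:
  fixes a b :: "'a :: real_or_complex"
  assumes real: "range (to_complex :: 'a \<Rightarrow> complex) = \<real>" and b: "b \<noteq> 0"
  shows "det (real_jordan_block k a b) \<noteq> 0"
proof -
  have "to_complex a \<in> \<real>" "to_complex b \<in> \<real>" using real by blast+
  then obtain r s where r: "to_complex a = complex_of_real r" and s: "to_complex b = complex_of_real s"
    unfolding Reals_def by blast
  have "s \<noteq> 0" using b s by auto
  then have "complex_of_real r + \<i> * complex_of_real s \<noteq> 0" "complex_of_real r - \<i> * complex_of_real s \<noteq> 0"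
    by (auto simp: complex_eq_iff)
  moreover have "to_complex (det (real_jordan_block k a b)) =
      det (jordan_matrix [(k, complex_of_real r + \<i> * complex_of_real s),
        (k, complex_of_real r - \<i> * complex_of_real s)])"
    unfolding to_complex.hom_det[symmetric] complexify_real_jordan_block r s
    by (rule det_similar[OF real_jordan_block_similar])
  moreover have "\<dots> = (complex_of_real r + \<i> * complex_of_real s) ^ k *
      (complex_of_real r - \<i> * complex_of_real s) ^ k"
    unfolding jordan_matrix_def by (subst det_diag_block_mat) (auto simp: det_jordan_block)
  ultimately show ?thesis by auto
qed

text \<open>If F F v = 0, then u = F v and w = - v form a chain at infinity, because (F - 1) u = - F
  v = F w.\<close>

lemma kernel_stable_no_chain:
  fixes F :: "'a :: field mat"
  assumes F: "F \<in> carrier_mat n n" and nc: "no_chain_at_infinity n F (F - 1\<^sub>m n)"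
  shows "kernel_stable F"
  unfolding kernel_stable_def
proof (intro ballI impI)
  fix v assume "v \<in> carrier_vec (dim_col F)" "F *\<^sub>v (F *\<^sub>v v) = 0\<^sub>v (dim_row F)"
  then have v: "v \<in> carrier_vec n" and FF: "F *\<^sub>v (F *\<^sub>v v) = 0\<^sub>v n" using F by auto
  have Fv: "F *\<^sub>v v \<in> carrier_vec n" using F v by simp
  have "F *\<^sub>v (- v) = - (F *\<^sub>v v)" using F v by (intro eq_vecI) auto
  also have "\<dots> = (F - 1\<^sub>m n) *\<^sub>v (F *\<^sub>v v)"
    using F v Fv FF by (auto simp: minus_mult_distrib_mat_vec[of _ n n])
  finally have "F *\<^sub>v v = 0\<^sub>v n"
    using nc Fv FF v unfolding no_chain_at_infinity_def by auto
  then show "F *\<^sub>v v = 0\<^sub>v (dim_row F)" using F by simp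
qed

text \<open>A Fitting decomposition whose nilpotent part is zero. The Jordan blocks are sorted by
  their determinants: the nonsingular ones make up \<open>C\<close>, and kernel stability reduces
  the singular ones to 1-by-1 zero blocks.\<close>

lemma kernel_splitting:
  fixes F :: "'a :: real_or_complex mat"
  assumes F: "F \<in> carrier_mat n n" and nc: "no_chain_at_infinity n F (F - 1\<^sub>m n)"
  obtains C n0 m where "C \<in> carrier_mat n0 n0" "det C \<noteq> 0" "n = n0 + m"
    "similar_mat F (block_diag C (0\<^sub>m m m))"
proof -
  obtain J where J: "jordan_canonical J" "similar_mat F J" using jordan_canonical_exists[OF F] by blast
  from J(1) obtain Bs where Bs: "J = diag_block_mat Bs"
    and blocks: "\<And>B. B \<in> set Bs \<Longrightarrow> (\<exists>k a. 0 < k \<and> B = jordan_block k a) \<or>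
      range (to_complex :: 'a \<Rightarrow> complex) = \<real> \<and> (\<exists>k a b. 0 < k \<and> 0 < b \<and> B = real_jordan_block k a b)"
    unfolding jordan_canonical_def by blast
  have square: "square_mat B" if "B \<in> set Bs" for B
    using blocks[OF that] by (auto simp: jordan_block_def real_jordan_block_def)
  define Ns Zs where "Ns = filter (\<lambda>B. det B \<noteq> 0) Bs" and "Zs = filter (\<lambda>B. det B = 0) Bs"
  have NZ: "set Ns \<subseteq> set Bs" "set Zs \<subseteq> set Bs" unfolding Ns_def Zs_def by auto
  have "mset Bs = mset (Ns @ Zs)" unfolding Ns_def Zs_def by (induct Bs) auto
  then have "similar_mat J (diag_block_mat (Ns @ Zs))"
    unfolding Bs using square by (intro similar_diag_block_mat_permute)
  with J(2) have sim: "similar_mat F (diag_block_mat (Ns @ Zs))" by (rule similar_mat_trans)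
  have "kernel_stable (diag_block_mat (Ns @ Zs))"
  proof (rule kernel_stable_no_chain)
    show "diag_block_mat (Ns @ Zs) \<in> carrier_mat n n"
      using similar_mat_to_detD[OF F sim] by blast
    show "no_chain_at_infinity n (diag_block_mat (Ns @ Zs)) (diag_block_mat (Ns @ Zs) - 1\<^sub>m n)"
      using F by (intro no_chain_at_infinity_strictly_equivalent[OF F _ nc]
          strictly_equivalent_similar[OF F sim]) auto
  qed
  then have stable: "kernel_stable B" if "B \<in> set Zs" for B
    by (rule kernel_stable_diag_block_matD) (use that NZ square in auto)
  have zero: "B = 0\<^sub>m (dim_row B) (dim_row B)" if B: "B \<in> set Zs" for B
  proof -
    have "det B = 0" "B \<in> set Bs" using B unfolding Zs_def by auto
    with blocks[of B] obtain k a where k: "0 < k" and Bk: "B = jordan_block k a"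
      using det_real_jordan_block by (metis order_less_irrefl)
    then have "det (jordan_block k a) = 0" using \<open>det B = 0\<close> by simp
    then have a: "a = 0" unfolding det_jordan_block by simp
    have "kernel_stable (jordan_block k (0 :: 'a))" using stable[OF B] unfolding Bk a .
    then have "k \<le> 1" by (rule kernel_stable_nilpotent_jordan_block)
    then have "k = 1" using k by simp
    have "jordan_block 1 0 = (0\<^sub>m 1 1 :: 'a mat)" by (intro eq_matI) (auto simp: jordan_block_def)
    then show ?thesis unfolding Bk a \<open>k = 1\<close> by simp
  qed
  define C n0 m where "C = diag_block_mat Ns" and "n0 = sum_list (map dim_row Ns)"
    and "m = sum_list (map dim_row Zs)"
  have C: "C \<in> carrier_mat n0 n0"
    unfolding C_def n0_def using NZ square by (intro diag_block_mat_square_carrier) auto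
  have "det C = prod_list (map det Ns)"
    unfolding C_def using NZ square by (intro det_diag_block_mat) auto
  also have "\<dots> \<noteq> 0" unfolding Ns_def by (induct Bs) auto
  finally have det: "det C \<noteq> 0" .
  have Z: "diag_block_mat Zs = 0\<^sub>m m m"
    unfolding m_def by (rule diag_block_mat_zero[OF zero])
  have sim': "similar_mat F (block_diag C (0\<^sub>m m m))"
    using sim unfolding diag_block_mat_append C_def[symmetric] Z Let_def .
  have "block_diag C (0\<^sub>m m m) \<in> carrier_mat n n"
    using similar_mat_to_detD[OF F sim'] by blast
  then have "n = n0 + m" using C by auto
  with C det sim' show thesis using that by blast
qed

text \<open>The similarity is padded with an identity block; being a conjugation, it leaves the
  leading coefficient unchanged.\<close>

lemma strictly_equivalent_block_similar:
  fixes B :: "'a :: field mat"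
  assumes B: "B \<in> carrier_mat n0 n0" and sim: "similar_mat B J"
  shows "strictly_equivalent (n0 + m) (block_diag (1\<^sub>m n0) (0\<^sub>m m m)) (block_diag B (1\<^sub>m m))
    (block_diag (1\<^sub>m n0) (0\<^sub>m m m)) (block_diag J (1\<^sub>m m))"
proof -
  from similar_mat_sym[OF sim] obtain P Q where w: "similar_mat_wit J B P Q"
    unfolding similar_mat_def by blast
  have "dim_row J = n0" using similar_mat_to_detD[OF B sim] by (metis carrier_matD(1))
  note w = similar_mat_witD[OF this[symmetric] w]
  have det: "det P \<noteq> 0" "det Q \<noteq> 0" using det_nonzero_left_inverse[OF w(6,7,1)] by auto
  note P1 = w(6) one_carrier_mat[of m] and Q1 = w(7) one_carrier_mat[of m]
  have dets: "det (block_diag P (1\<^sub>m m)) \<noteq> 0" "det (block_diag Q (1\<^sub>m m)) \<noteq> 0"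
    using det unfolding det_block_diag[OF P1] det_block_diag[OF Q1] by simp_all
  show ?thesis
  proof (rule strictly_equivalentI[of "block_diag P (1\<^sub>m m)" _ "block_diag Q (1\<^sub>m m)"])
    show "block_diag P (1\<^sub>m m) * block_diag (1\<^sub>m n0) (0\<^sub>m m m) * block_diag Q (1\<^sub>m m) =
        block_diag (1\<^sub>m n0) (0\<^sub>m m m)"
      unfolding block_diag_mult[OF P1 one_carrier_mat zero_carrier_mat]
        block_diag_mult[OF mult_carrier_mat[OF w(6) one_carrier_mat]
          mult_carrier_mat[OF one_carrier_mat zero_carrier_mat] Q1]
      using w by simp
    show "block_diag P (1\<^sub>m m) * block_diag B (1\<^sub>m m) * block_diag Q (1\<^sub>m m) =
        block_diag J (1\<^sub>m m)"
      unfolding block_diag_mult[OF P1 B one_carrier_mat]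
        block_diag_mult[OF mult_carrier_mat[OF w(6) B]
          mult_carrier_mat[OF one_carrier_mat one_carrier_mat] Q1]
      using w(3) by simp
  qed (use w(6,7) dets in auto)
qed

lemma weierstrass_form_exists:
  fixes E A :: "'a :: real_or_complex mat"
  assumes E: "E \<in> carrier_mat n n" and A: "A \<in> carrier_mat n n"
    and det: "det (E - A) \<noteq> 0" and nc: "no_chain_at_infinity n E A"
  shows "\<exists>S T J ks. weierstrass_form E A S T J ks"
proof -
  have EA: "E - A \<in> carrier_mat n n" using A by (rule minus_carrier_mat)
  obtain G where G: "G \<in> carrier_mat n n" "(E - A) * G = 1\<^sub>m n" "G * (E - A) = 1\<^sub>m n"
    using det_nonzero_obtain_inverse[OF EA det] .
  define F where "F = G * E"
  have F: "F \<in> carrier_mat n n" using G E unfolding F_def by simp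
  \<comment> \<open>This is \<open>G * (E - A) = 1\<^sub>m n\<close>, solved for
    \<open>G * A\<close>.\<close>
  have "G * A = F - 1\<^sub>m n"
    unfolding F_def G(3)[symmetric] using G(1) E A
    by (intro eq_matI) (auto simp: mult_minus_distrib_mat[of _ n n _ n])
  then have 1: "strictly_equivalent n E A F (F - 1\<^sub>m n)"
    using G E A det_nonzero_left_inverse[OF G(1) EA G(3)] unfolding F_def
    by (intro strictly_equivalentI[of G n "1\<^sub>m n"]) auto
  have F1: "F - 1\<^sub>m n \<in> carrier_mat n n" by (intro minus_carrier_mat one_carrier_mat)
  obtain C n0 m where C: "C \<in> carrier_mat n0 n0" "det C \<noteq> 0" and n: "n = n0 + m"
    and sim: "similar_mat F (block_diag C (0\<^sub>m m m))"
    using kernel_splitting[OF F no_chain_at_infinity_strictly_equivalent[OF E A nc 1]] .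
  have 2: "strictly_equivalent n F (F - 1\<^sub>m n) (block_diag C (0\<^sub>m m m)) (block_diag C (0\<^sub>m m m) - 1\<^sub>m n)"
    using strictly_equivalent_similar[OF F sim] .
  obtain C' where C': "C' \<in> carrier_mat n0 n0" "C * C' = 1\<^sub>m n0" "C' * C = 1\<^sub>m n0"
    using det_nonzero_obtain_inverse[OF C] .
  \<comment> \<open>Left multiplication by C^-1 turns s C - (C - 1) into s - (1 - C^-1). On the
    other block the constant coefficient is 0 - 1, whence the factor - 1 in
    \<open>S\<close>.\<close>
  define B where "B = 1\<^sub>m n0 - C'"
  have B: "B \<in> carrier_mat n0 n0" unfolding B_def using C'(1) by (rule minus_carrier_mat)
  define S where "S = block_diag C' (- 1\<^sub>m m)"
  have S: "S \<in> carrier_mat n n" unfolding S_def n using C' by simp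
  have m1: "- 1\<^sub>m m \<in> carrier_mat m m" by simp
  have 3: "strictly_equivalent n (block_diag C (0\<^sub>m m m)) (block_diag C (0\<^sub>m m m) - 1\<^sub>m n)
      (block_diag (1\<^sub>m n0) (0\<^sub>m m m)) (block_diag B (1\<^sub>m m))"
  proof (rule strictly_equivalentI[OF S one_carrier_mat])
    have "det (- 1\<^sub>m m :: 'a mat) \<noteq> 0"
      using det_0_negate[of "1\<^sub>m m :: 'a mat" m] by simp
    then show "det S \<noteq> 0"
      using det_nonzero_left_inverse[OF C'(1) C(1) C'(3)] unfolding S_def det_block_diag[OF C'(1) m1] by simp
    have "S * block_diag C (0\<^sub>m m m) = block_diag (C' * C) (- 1\<^sub>m m * 0\<^sub>m m m)"
      unfolding S_def by (rule block_diag_mult[OF C'(1) m1 C(1) zero_carrier_mat])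
    also have "\<dots> = block_diag (1\<^sub>m n0) (0\<^sub>m m m)" using m1 C' by simp
    finally show "S * block_diag C (0\<^sub>m m m) * 1\<^sub>m n = block_diag (1\<^sub>m n0) (0\<^sub>m m m)"
      using n by simp
    have "block_diag C (0\<^sub>m m m) - 1\<^sub>m n = block_diag (C - 1\<^sub>m n0) (0\<^sub>m m m - 1\<^sub>m m)"
      unfolding n block_diag_one[symmetric]
      by (rule block_diag_minus[OF C(1) zero_carrier_mat one_carrier_mat one_carrier_mat])
    moreover have "S * block_diag (C - 1\<^sub>m n0) (0\<^sub>m m m - 1\<^sub>m m) =
        block_diag (C' * (C - 1\<^sub>m n0)) (- 1\<^sub>m m * (0\<^sub>m m m - 1\<^sub>m m))"
      unfolding S_def
      by (rule block_diag_mult[OF C'(1) m1]) (intro minus_carrier_mat one_carrier_mat)+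
    moreover have "C' * (C - 1\<^sub>m n0) = B"
      using C C' unfolding B_def by (simp add: mult_minus_distrib_mat[of _ n0 n0 _ n0])
    moreover have "- 1\<^sub>m m * (0\<^sub>m m m - 1\<^sub>m m) = (1\<^sub>m m :: 'a mat)"
    proof -
      have "0\<^sub>m m m - 1\<^sub>m m = (- 1\<^sub>m m :: 'a mat)" by (intro eq_matI) auto
      then show ?thesis by simp
    qed
    ultimately show "S * (block_diag C (0\<^sub>m m m) - 1\<^sub>m n) * 1\<^sub>m n = block_diag B (1\<^sub>m m)"
      using n B by (metis four_block_carrier_mat one_carrier_mat right_mult_one_mat)
  qed simp
  obtain J where J: "jordan_canonical J" "similar_mat B J" using jordan_canonical_exists[OF B] by blast
  have 4: "strictly_equivalent n (block_diag (1\<^sub>m n0) (0\<^sub>m m m)) (block_diag B (1\<^sub>m m))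
      (block_diag (1\<^sub>m n0) (0\<^sub>m m m)) (block_diag J (1\<^sub>m m))"
    unfolding n by (rule strictly_equivalent_block_similar[OF B J(2)])
  have D: "block_diag C (0\<^sub>m m m) \<in> carrier_mat n n" using C n by simp
  have D1: "block_diag C (0\<^sub>m m m) - 1\<^sub>m n \<in> carrier_mat n n"
    by (intro minus_carrier_mat one_carrier_mat)
  have "strictly_equivalent n E A (block_diag (1\<^sub>m n0) (0\<^sub>m m m)) (block_diag J (1\<^sub>m m))"
    by (rule strictly_equivalent_trans[OF E A 1 strictly_equivalent_trans[OF F F1 2
            strictly_equivalent_trans[OF D D1 3 4]]])
  then obtain S T where ST: "S \<in> carrier_mat n n" "T \<in> carrier_mat n n" "det S \<noteq> 0" "det T \<noteq> 0"
    "S * E * T = block_diag (1\<^sub>m n0) (0\<^sub>m m m)" "S * A * T = block_diag J (1\<^sub>m m)"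
    unfolding strictly_equivalent_def by blast
  have "dim_row J = n0" using similar_mat_to_detD[OF B J(2)] by (metis carrier_matD(1))
  moreover have "sum_list (replicate m 1) = m" by (simp add: sum_list_replicate)
  moreover have "nilpotent_jordan (replicate m 1) = (0\<^sub>m m m :: 'a mat)"
    using nilpotent_jordan_ones[of "replicate m 1", where 'a = 'a] by (simp add: sum_list_replicate)
  \<comment> \<open>The zero block of size \<open>m\<close> counts as \<open>m\<close> nilpotent
    Jordan blocks of size 1.\<close>
  ultimately have "weierstrass_form E A S T J (replicate m 1)"
    unfolding weierstrass_form_iff[OF E A] using ST J(1) n by auto
  then show ?thesis by blast
qed

section \<open>Dissipative relations\<close>

text \<open>Dissipativity involves only real parts, and on these the inner product is a symmetric
  real-bilinear form over either scalar field.\<close>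

abbreviation re_inner :: "'a :: real_or_complex vec \<Rightarrow> 'a vec \<Rightarrow> real" where
  "re_inner x y \<equiv> Re (to_complex (x \<bullet>c y))"

lemma re_inner_commute:
  assumes "x \<in> carrier_vec n" "y \<in> carrier_vec n"
  shows "re_inner x y = re_inner y x"
proof -
  have "y \<bullet>c x = conjugate (x \<bullet>c y)"
    using assms by (metis conjugate_conjugate_sprod conjugate_vec_sprod_comm)
  then show ?thesis by (simp add: to_complex_conjugate)
qed

lemma re_inner_add_left:
  assumes "x \<in> carrier_vec n" "y \<in> carrier_vec n" "z \<in> carrier_vec n"
  shows "re_inner (x + y) z = re_inner x z + re_inner y z"
  using assms by (simp add: add_scalar_prod_distrib[of _ n] to_complex_add)

lemma re_inner_add_right:
  assumes "x \<in> carrier_vec n" "y \<in> carrier_vec n" "z \<in> carrier_vec n"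
  shows "re_inner z (x + y) = re_inner z x + re_inner z y"
  using re_inner_add_left[OF assms] assms by (simp add: re_inner_commute[of z n])

lemma re_inner_uminus_right:
  assumes "x \<in> carrier_vec n" "y \<in> carrier_vec n"
  shows "re_inner x (- y) = - re_inner x y"
  using assms by (simp add: uminus_conjugate_vec[symmetric] to_complex_uminus)

lemma re_inner_smult_right:
  assumes "x \<in> carrier_vec n" "y \<in> carrier_vec n" "to_complex c = complex_of_real r"
  shows "re_inner x (c \<cdot>\<^sub>v y) = r * re_inner x y"
  using assms by (simp add: conjugate_smult_vec to_complex_mult to_complex_conjugate)

lemma re_inner_self_pos:
  assumes "x \<in> carrier_vec n" "x \<noteq> 0\<^sub>v n"
  shows "0 < re_inner x x"
proof -
  have pos: "0 < x \<bullet>c x" using assms by simp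
  then have "0 \<le> to_complex (x \<bullet>c x)"
    using to_complex_less_eq[of 0 "x \<bullet>c x"] by (simp add: less_imp_le)
  moreover have "to_complex (x \<bullet>c x) \<noteq> 0" using pos by auto
  ultimately show ?thesis by (auto simp: less_eq_complex_def complex_eq_iff)
qed

lemma real_in_range_to_complex:
  obtains c :: "'a :: real_or_complex" where "to_complex c = complex_of_real r"
proof -
  have "complex_of_real r \<in> range (to_complex :: 'a \<Rightarrow> complex)"
    using range_to_complex[where 'a = 'a] by auto
  then show thesis using that by auto
qed

lemma positive_definite_pos:
  fixes x :: "'a :: real_or_complex vec"
  assumes Q: "positive_definite n Q" and x: "x \<in> carrier_vec n" "x \<noteq> 0\<^sub>v n"
  shows "0 < re_inner (Q *\<^sub>v x) x"
proof -
  have pos: "0 < (Q *\<^sub>v x) \<bullet>c x" using assms unfolding positive_definite_def by blast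
  then have "0 \<le> to_complex ((Q *\<^sub>v x) \<bullet>c x)"
    using to_complex_less_eq[of 0 "(Q *\<^sub>v x) \<bullet>c x"] by (simp add: less_imp_le)
  moreover have "to_complex ((Q *\<^sub>v x) \<bullet>c x) \<noteq> 0" using pos by auto
  ultimately show ?thesis by (auto simp: less_eq_complex_def complex_eq_iff)
qed

lemma linear_relationI:
  fixes M :: "('a :: field vec \<times> 'a vec) set"
  assumes sub: "M \<subseteq> carrier_vec n \<times> carrier_vec n"
    and zero: "(0\<^sub>v n, 0\<^sub>v n) \<in> M"
    and add: "\<And>x y x' y'. (x, y) \<in> M \<Longrightarrow> (x', y') \<in> M \<Longrightarrow> (x + x', y + y') \<in> M"
    and smult: "\<And>c x y. (x, y) \<in> M \<Longrightarrow> (c \<cdot>\<^sub>v x, c \<cdot>\<^sub>v y) \<in> M"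
  shows "linear_relation n M"
  unfolding linear_relation_def
proof
  let ?W = "(\<lambda>(x, y). x @\<^sub>v y) ` M"
  show "VectorSpace.subspace class_ring ?W (module_vec TYPE('a) (2 * n))"
  proof (intro VectorSpace.subspace.intro submodule.intro vec_vs vec_module, unfold module_vec_simps)
    show "?W \<subseteq> carrier_vec (2 * n)" using sub by (auto simp: mult_2)
    have "0\<^sub>v n @\<^sub>v 0\<^sub>v n = (0\<^sub>v (2 * n) :: 'a vec)" by (intro eq_vecI) auto
    then show "0\<^sub>v (2 * n) \<in> ?W" using zero by force
  next
    fix v w assume "v \<in> ?W" "w \<in> ?W"
    then obtain x y x' y' where M: "(x, y) \<in> M" "(x', y') \<in> M"
      and vw: "v = x @\<^sub>v y" "w = x' @\<^sub>v y'" by auto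
    have "x \<in> carrier_vec n" "y \<in> carrier_vec n" "x' \<in> carrier_vec n" "y' \<in> carrier_vec n"
      using M sub by auto
    then have "v + w = (x + x') @\<^sub>v (y + y')" unfolding vw by (intro eq_vecI) auto
    then show "v + w \<in> ?W" using add[OF M] by force
  next
    fix c :: 'a and v assume "v \<in> ?W"
    then obtain x y where M: "(x, y) \<in> M" and v: "v = x @\<^sub>v y" by auto
    have "c \<cdot>\<^sub>v v = (c \<cdot>\<^sub>v x) @\<^sub>v (c \<cdot>\<^sub>v y)" unfolding v by (intro eq_vecI) auto
    then show "c \<cdot>\<^sub>v v \<in> ?W" using smult[OF M] by force
  qed
qed (rule sub)

section \<open>Consequences of maximality\<close>

text \<open>The orthogonal complement of the range is the kernel of the adjoint; its elements are
  the conjugates of the kernel vectors of the transpose.\<close>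

lemma singular_mat_orthogonal_range:
  fixes M :: "'a :: real_or_complex mat"
  assumes M: "M \<in> carrier_mat n n" and det: "det M = 0"
  obtains w where "w \<in> carrier_vec n" "w \<noteq> 0\<^sub>v n"
    "\<And>v. v \<in> carrier_vec n \<Longrightarrow> (M *\<^sub>v v) \<bullet>c w = 0"
proof -
  have "det (transpose_mat M) = 0" using M det by (simp add: det_transpose)
  then obtain u where u: "u \<in> carrier_vec n" "u \<noteq> 0\<^sub>v n" "transpose_mat M *\<^sub>v u = 0\<^sub>v n"
    using det_0_iff_vec_prod_zero_field[of "transpose_mat M" n] M by auto
  show thesis
  proof
    show "conjugate u \<in> carrier_vec n" "conjugate u \<noteq> 0\<^sub>v n" using u by auto
    fix v :: "'a vec" assume v: "v \<in> carrier_vec n"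
    have "(M *\<^sub>v v) \<bullet> u = u \<bullet> (M *\<^sub>v v)"
      using M v u by (intro comm_scalar_prod[of _ n]) auto
    also have "\<dots> = (transpose_mat M *\<^sub>v u) \<bullet> v"
      using transpose_vec_mult_scalar[OF M v u(1)] by simp
    also have "\<dots> = 0" using u v by simp
    finally show "(M *\<^sub>v v) \<bullet>c conjugate u = 0" by simp
  qed
qed

text \<open>Half of Minty's range condition: for a maximal relation the differences y - x of its
  pairs (x, y) fill the whole space, and here they form the range of \<open>C - B\<close>.\<close>

lemma maximally_dissipative_det:
  fixes B C :: "'a :: real_or_complex mat"
  assumes B: "B \<in> carrier_mat n n" and C: "C \<in> carrier_mat n n"
    and max: "maximally_dissipative n (range_of_pair B C)"
  shows "det (C - B) \<noteq> 0"
proof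
  assume "det (C - B) = 0"
  have CB: "C - B \<in> carrier_mat n n" using B by (rule minus_carrier_mat)
  obtain w where w: "w \<in> carrier_vec n" "w \<noteq> 0\<^sub>v n"
    and orth: "\<And>v. v \<in> carrier_vec n \<Longrightarrow> ((C - B) *\<^sub>v v) \<bullet>c w = 0"
    using singular_mat_orthogonal_range[OF CB \<open>det (C - B) = 0\<close>] by blast
  have orth: "(C *\<^sub>v v) \<bullet>c w = (B *\<^sub>v v) \<bullet>c w" if v: "v \<in> carrier_vec n" for v
    using orth[OF v] v B C w
    by (simp add: minus_mult_distrib_mat_vec[of _ n n] minus_scalar_prod_distrib[of _ n])
  define M where "M = {(B *\<^sub>v v + c \<cdot>\<^sub>v w, C *\<^sub>v v - c \<cdot>\<^sub>v w) | v c. v \<in> carrier_vec n}"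
  have M: "(B *\<^sub>v v + c \<cdot>\<^sub>v w, C *\<^sub>v v - c \<cdot>\<^sub>v w) \<in> M" if "v \<in> carrier_vec n" for v c
    using that unfolding M_def by blast
  have zero: "B *\<^sub>v 0\<^sub>v n = 0\<^sub>v n" "C *\<^sub>v 0\<^sub>v n = 0\<^sub>v n"
    using B C by (auto intro!: eq_vecI)
  have "linear_relation n M"
  proof (rule linear_relationI)
    show "M \<subseteq> carrier_vec n \<times> carrier_vec n" using B C w unfolding M_def by auto
    have "0\<^sub>v n + 0 \<cdot>\<^sub>v w = 0\<^sub>v n" "0\<^sub>v n - 0 \<cdot>\<^sub>v w = 0\<^sub>v n" using w by (auto intro!: eq_vecI)
    then show "(0\<^sub>v n, 0\<^sub>v n) \<in> M" using M[of "0\<^sub>v n" 0] unfolding zero by simp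
  next
    fix x y x' y' assume "(x, y) \<in> M" "(x', y') \<in> M"
    then obtain v c v' c' where v: "v \<in> carrier_vec n" "v' \<in> carrier_vec n"
      and xy: "x = B *\<^sub>v v + c \<cdot>\<^sub>v w" "y = C *\<^sub>v v - c \<cdot>\<^sub>v w"
        "x' = B *\<^sub>v v' + c' \<cdot>\<^sub>v w" "y' = C *\<^sub>v v' - c' \<cdot>\<^sub>v w"
      unfolding M_def by blast
    have "x + x' = B *\<^sub>v (v + v') + (c + c') \<cdot>\<^sub>v w" "y + y' = C *\<^sub>v (v + v') - (c + c') \<cdot>\<^sub>v w"
      unfolding xy mult_add_distrib_mat_vec[OF B v] mult_add_distrib_mat_vec[OF C v]
      using v B C w by (auto intro!: eq_vecI simp: algebra_simps)
    then show "(x + x', y + y') \<in> M" using M[of "v + v'" "c + c'"] v by simp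
  next
    fix a x y assume "(x, y) \<in> M"
    then obtain v c where v: "v \<in> carrier_vec n"
      and xy: "x = B *\<^sub>v v + c \<cdot>\<^sub>v w" "y = C *\<^sub>v v - c \<cdot>\<^sub>v w"
      unfolding M_def by blast
    have "a \<cdot>\<^sub>v x = B *\<^sub>v (a \<cdot>\<^sub>v v) + (a * c) \<cdot>\<^sub>v w" "a \<cdot>\<^sub>v y = C *\<^sub>v (a \<cdot>\<^sub>v v) - (a * c) \<cdot>\<^sub>v w"
      unfolding xy mult_mat_vec[OF B v] mult_mat_vec[OF C v]
      using v B C w by (auto intro!: eq_vecI simp: algebra_simps)
    then show "(a \<cdot>\<^sub>v x, a \<cdot>\<^sub>v y) \<in> M" using M[of "a \<cdot>\<^sub>v v" "a * c"] v by simp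
  qed
  moreover have "dissipative M"
    unfolding dissipative_def
  proof clarify
    fix x y assume "(x, y) \<in> M"
    then obtain v c where v: "v \<in> carrier_vec n"
      and xy: "x = B *\<^sub>v v + c \<cdot>\<^sub>v w" "y = C *\<^sub>v v - c \<cdot>\<^sub>v w"
      unfolding M_def by blast
    define a b z where "a = B *\<^sub>v v" and "b = C *\<^sub>v v" and "z = c \<cdot>\<^sub>v w"
    have carrier: "a \<in> carrier_vec n" "b \<in> carrier_vec n" "z \<in> carrier_vec n"
      using v w B C unfolding a_def b_def z_def by auto
    \<comment> \<open>b - a lies in the range of \<open>C - B\<close> and is orthogonal to z, so the
      cross terms in Re <a + z, b - z> cancel and only Re <a, b> - <z, z> remains.\<close>
    have "b \<bullet>c z = a \<bullet>c z"
      using orth[OF v] carrier w unfolding a_def[symmetric] b_def[symmetric] z_def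
      by (simp add: conjugate_smult_vec)
    then have cross: "re_inner z b = re_inner a z"
      using carrier by (simp add: re_inner_commute[of z n b])
    have "y = b + - z" using carrier unfolding xy a_def b_def z_def by (intro eq_vecI) auto
    then have "re_inner x y = re_inner (a + z) (b + - z)" unfolding xy a_def z_def by simp
    also have "\<dots> = re_inner a b - re_inner z z"
      using carrier cross
      by (simp add: re_inner_add_left[of _ n] re_inner_add_right[of _ n] re_inner_uminus_right[of _ n])
    also have "\<dots> \<le> 0"
    proof -
      have "re_inner a b \<le> 0"
        using max v B unfolding maximally_dissipative_def dissipative_def range_of_pair_def a_def b_def
        by auto
      moreover have "0 \<le> re_inner z z"
        using re_inner_self_pos[of z n] carrier by (cases "z = 0\<^sub>v n") auto
      ultimately show ?thesis by simp
    qed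
    finally show "re_inner x y \<le> 0" .
  qed
  moreover have "range_of_pair B C \<subset> M"
  proof
    have "B *\<^sub>v v + 0 \<cdot>\<^sub>v w = B *\<^sub>v v" "C *\<^sub>v v - 0 \<cdot>\<^sub>v w = C *\<^sub>v v" if "v \<in> carrier_vec n" for v
      using B C w by (auto intro!: eq_vecI)
    then show "range_of_pair B C \<subseteq> M"
      using M[of _ 0] B unfolding range_of_pair_def by auto
    have "0\<^sub>v n + 1 \<cdot>\<^sub>v w = w" "0\<^sub>v n - 1 \<cdot>\<^sub>v w = - w" using w by (auto intro!: eq_vecI)
    then have "(w, - w) \<in> M" using M[of "0\<^sub>v n" 1] unfolding zero by simp
    \<comment> \<open>Membership would put - 2 w into the range of \<open>C - B\<close>, to which w
      is orthogonal.\<close>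
    moreover have "(w, - w) \<notin> range_of_pair B C"
    proof
      assume "(w, - w) \<in> range_of_pair B C"
      then obtain v where v: "v \<in> carrier_vec n" "w = B *\<^sub>v v" "- w = C *\<^sub>v v"
        using B unfolding range_of_pair_def by auto
      have "(- w) \<bullet>c w = w \<bullet>c w" using orth[OF v(1)] v(2,3) by simp
      then have "- re_inner w w = re_inner w w"
        using w by (metis re_inner_commute re_inner_uminus_right uminus_carrier_vec)
      then show False using re_inner_self_pos[OF w] by simp
    qed
    ultimately show "range_of_pair B C \<noteq> M" by blast
  qed
  ultimately show False using max unfolding maximally_dissipative_def by blast
qed

lemma maximally_dissipative_pencil:
  fixes E A Q :: "'a :: real_or_complex mat"
  assumes E: "E \<in> carrier_mat n n" and A: "A \<in> carrier_mat n n"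
    and max: "maximally_dissipative n D" and Q: "positive_definite n Q"
    and range: "range_of_pair E A = (graph_of Q)\<inverse> O D"
  shows "det (E - A) \<noteq> 0" "no_chain_at_infinity n E A"
proof -
  have Qc: "Q \<in> carrier_mat n n" using Q unfolding positive_definite_def by blast
  have "det Q \<noteq> 0"
  proof (rule det_nonzeroI[OF Qc], rule ccontr)
    fix x assume x: "x \<in> carrier_vec n" "Q *\<^sub>v x = 0\<^sub>v n" "x \<noteq> 0\<^sub>v n"
    then show False using positive_definite_pos[OF Q x(1,3)] by simp
  qed
  then obtain P where P: "P \<in> carrier_mat n n" "Q * P = 1\<^sub>m n" "P * Q = 1\<^sub>m n"
    using det_nonzero_obtain_inverse[OF Qc] by blast
  have PQ: "P *\<^sub>v (Q *\<^sub>v x) = x" and QP: "Q *\<^sub>v (P *\<^sub>v x) = x" if "x \<in> carrier_vec n" for x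
    using that P Qc by (simp_all flip: assoc_mult_mat_vec[of _ n n _ n])
  \<comment> \<open>The inverse inherits positivity through the substitution y = Q x.\<close>
  have Ppos: "0 < re_inner (P *\<^sub>v y) y" if y: "y \<in> carrier_vec n" "y \<noteq> 0\<^sub>v n" for y
  proof -
    have x: "P *\<^sub>v y \<in> carrier_vec n" using P y by simp
    have "P *\<^sub>v y \<noteq> 0\<^sub>v n"
    proof
      assume "P *\<^sub>v y = 0\<^sub>v n"
      moreover have "Q *\<^sub>v 0\<^sub>v n = 0\<^sub>v n" using Qc by (auto intro!: eq_vecI)
      ultimately show False using QP[OF y(1)] y(2) by simp
    qed
    from positive_definite_pos[OF Q x this] show ?thesis
      unfolding QP[OF y(1)] using re_inner_commute[OF y(1) x] by simp
  qed
  define B where "B = P * E"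
  have B: "B \<in> carrier_mat n n" using P E unfolding B_def by simp
  have Bv: "B *\<^sub>v v = P *\<^sub>v (E *\<^sub>v v)" if "v \<in> carrier_vec n" for v
    using that P E unfolding B_def by simp
  have "D = range_of_pair B A"
  proof (intro equalityI subrelI)
    fix x z assume xz: "(x, z) \<in> D"
    moreover have x: "x \<in> carrier_vec n"
      using xz max unfolding maximally_dissipative_def linear_relation_def by blast
    ultimately have "(Q *\<^sub>v x, z) \<in> range_of_pair E A"
      unfolding range graph_of_def using Qc by auto
    then obtain v where v: "v \<in> carrier_vec n" "Q *\<^sub>v x = E *\<^sub>v v" "z = A *\<^sub>v v"
      unfolding range_of_pair_def using E by auto
    have "x = B *\<^sub>v v" using PQ[OF x] Bv[OF v(1)] v(2) by simp
    then show "(x, z) \<in> range_of_pair B A" using v B unfolding range_of_pair_def by auto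
  next
    fix x z assume "(x, z) \<in> range_of_pair B A"
    then obtain v where v: "v \<in> carrier_vec n" "x = B *\<^sub>v v" "z = A *\<^sub>v v"
      unfolding range_of_pair_def using B by auto
    then have "(E *\<^sub>v v, z) \<in> range_of_pair E A" using E unfolding range_of_pair_def by auto
    then obtain x' where x': "x' \<in> carrier_vec n" "E *\<^sub>v v = Q *\<^sub>v x'" "(x', z) \<in> D"
      unfolding range graph_of_def using Qc by auto
    have "x = x'" using PQ[OF x'(1)] Bv[OF v(1)] v(2) x'(2) by simp
    then show "(x, z) \<in> D" using x'(3) by simp
  qed
  with max have max': "maximally_dissipative n (range_of_pair B A)" by simp
  have diss: "re_inner (P *\<^sub>v (E *\<^sub>v v)) (A *\<^sub>v v) \<le> 0" if v: "v \<in> carrier_vec n" for v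
  proof -
    have "(B *\<^sub>v v, A *\<^sub>v v) \<in> range_of_pair B A" using v B unfolding range_of_pair_def by auto
    then show ?thesis
      using max' unfolding maximally_dissipative_def dissipative_def Bv[OF v] by auto
  qed
  have common: "v = 0\<^sub>v n" if v: "v \<in> carrier_vec n" "E *\<^sub>v v = 0\<^sub>v n" "A *\<^sub>v v = 0\<^sub>v n" for v
  proof -
    have "P *\<^sub>v 0\<^sub>v n = 0\<^sub>v n" using P by (auto intro!: eq_vecI)
    then have "(A - B) *\<^sub>v v = 0\<^sub>v n"
      using v A B Bv[OF v(1)] by (simp add: minus_mult_distrib_mat_vec[of _ n n])
    then show ?thesis
      using det_nonzeroD[OF minus_carrier_mat[OF B] maximally_dissipative_det[OF B A max'] v(1)] by simp
  qed
  show "det (E - A) \<noteq> 0"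
  proof (rule det_nonzeroI[OF minus_carrier_mat[OF A]])
    fix v assume v: "v \<in> carrier_vec n" and "(E - A) *\<^sub>v v = 0\<^sub>v n"
    then have "E *\<^sub>v v - A *\<^sub>v v = 0\<^sub>v n" using E A by (simp add: minus_mult_distrib_mat_vec[of _ n n])
    then have EA: "A *\<^sub>v v = E *\<^sub>v v"
      using E A v by (auto simp: vec_eq_iff)
    \<comment> \<open>With A v = E v the dissipation inequality bounds <P E v, E v> above by
      0.\<close>
    have "E *\<^sub>v v = 0\<^sub>v n"
      using Ppos[of "E *\<^sub>v v"] diss[OF v] E v unfolding EA by force
    then show "v = 0\<^sub>v n" using common v EA by simp
  qed
  show "no_chain_at_infinity n E A"
    unfolding no_chain_at_infinity_def
  proof (intro ballI impI)
    fix u w assume u: "u \<in> carrier_vec n" and w: "w \<in> carrier_vec n"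
      and Eu: "E *\<^sub>v u = 0\<^sub>v n" and Ew: "E *\<^sub>v w = A *\<^sub>v u"
    define y where "y = E *\<^sub>v w"
    have y: "y \<in> carrier_vec n" "P *\<^sub>v y \<in> carrier_vec n" using E P w unfolding y_def by auto
    have Aw: "A *\<^sub>v w \<in> carrier_vec n" using A w by simp
    \<comment> \<open>Since E u = 0, moving from w to w + t u keeps E w = y fixed but adds t A u = t
      y to A w. Dissipativity thus bounds an affine function of t from above, and its slope <P y, y>
      cannot be positive.\<close>
    have "re_inner (P *\<^sub>v y) (A *\<^sub>v w) + t * re_inner (P *\<^sub>v y) y \<le> 0" for t
    proof -
      obtain c :: 'a where c: "to_complex c = complex_of_real t"
        using real_in_range_to_complex by blast
      have c0: "c \<cdot>\<^sub>v 0\<^sub>v n = 0\<^sub>v n" by (intro eq_vecI) auto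
      have v: "w + c \<cdot>\<^sub>v u \<in> carrier_vec n" using u w by simp
      have "E *\<^sub>v (w + c \<cdot>\<^sub>v u) = y"
        using E u w c0 unfolding y_def
        by (simp add: mult_add_distrib_mat_vec[of _ n n] mult_mat_vec[of _ n n] Eu)
      moreover have "A *\<^sub>v (w + c \<cdot>\<^sub>v u) = A *\<^sub>v w + c \<cdot>\<^sub>v y"
        using A u w unfolding y_def
        by (simp add: mult_add_distrib_mat_vec[of _ n n] mult_mat_vec[of _ n n] Ew)
      ultimately show ?thesis
        using diss[OF v] y Aw c
        by (simp add: re_inner_add_right[of _ n] re_inner_smult_right[of _ n])
    qed
    \<comment> \<open>At this value of t the affine function equals 1 whenever y is nonzero.\<close>
    from this[of "(1 - re_inner (P *\<^sub>v y) (A *\<^sub>v w)) / re_inner (P *\<^sub>v y) y"]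
    have "y = 0\<^sub>v n" using Ppos[OF y(1)] by (cases "y = 0\<^sub>v n") auto
    then show "u = 0\<^sub>v n" using common[OF u Eu] Ew unfolding y_def by simp
  qed
qed

theorem corollary6p5:
  fixes n :: nat
    and E A Q :: "'a :: real_or_complex mat"
    and D L :: "('a vec \<times> 'a vec) set"
  assumes "E \<in> carrier_mat n n" and "A \<in> carrier_mat n n"
    and "maximally_dissipative n D"
    and "positive_definite n Q"
    and "L = (graph_of Q)\<inverse>"
    and "range_of_pair E A = L O D"
  shows "regular_pencil E A \<and> pencil_index E A \<le> 1"
proof
  note E = assms(1) and A = assms(2)
  note pencil = maximally_dissipative_pencil[OF E A assms(3,4) assms(6)[unfolded assms(5)]]
  have "1 \<cdot>\<^sub>m E - A = E - A" using E A by (intro eq_matI) auto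
  then have "poly (det (pencil E A)) 1 \<noteq> 0"
    unfolding poly_det_pencil[OF E A] using pencil(1) by simp
  then show "regular_pencil E A" unfolding regular_pencil_def by auto
  \<comment> \<open>Some form exists, and every form gives the value determined by
    \<open>det E\<close>; together these evaluate the definite description.\<close>
  have "pencil_index E A = (if det E = 0 then 1 else 0)"
    unfolding pencil_index_def
    using weierstrass_form_exists[OF E A pencil] weierstrass_form_index[OF E A pencil(2)]
    by (intro the_equality) (metis, blast)
  then show "pencil_index E A \<le> 1" by simp
qed

end
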